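(* Let $\mathsf C$ and $\mathsf D$ be locally small concrete monoidal categories, with $\mathsf D$ cartesian monoidal. Let $\mathcal T,\mathcal U:\mathsf C\to\mathsf D$ be strong monoidal functors and $\tau:\mathcal T\Rightarrow\mathcal U$ a $\mathsf D$-fibered monoidal natural transformation. Let $\mathsf A\subseteq\mathrm{Arrow}(\mathsf C)$ be a cartesian monoidal subcategory (so that the product assignment $\Pi:((\mathsf{FinSet}/\mathsf A)^{\Leftarrow})^{op}\to\mathsf A$ is functorial). Let $$((\varphi,\Phi),f):(\mathcal A_X,\ \iota_X:a\to\Pi(\mathcal A_X))\to(\mathcal A_Y,\ \iota_Y:a'\to\Pi(\mathcal A_Y))$$ be a morphism of networks of $\mathsf A$-open $\tau$-systems. Then there is an induced 1-morphism $$\begin{array}{ccc}\prod_{y\in Y}\Gamma_\tau(\mathcal A_{Y,y})&\xrightarrow{\ \Gamma_\tau(\varphi,\Phi)\ }&\prod_{x\in X}\Gamma_\tau(\mathcal A_{X,x})\\ {\scriptstyle\Gamma_\tau(\iota_Y)\circ\mathscr P_Y}\downarrow&\Downarrow&\downarrow{\scriptstyle\Gamma_\tau(\iota_X)\circ\mathscr P_X}\\ \Gamma_\tau(a')&\xrightarrow{\ \Gamma_\tau(f)\ }&\Gamma_\tau(a)\end{array}$$ in $\mathsf{Set}^\square$ (horizontal arrows are relations, vertical arrows are functions), where $$\Gamma_\tau(\varphi,\Phi)=\Big\{\big((w_y)_{y\in Y},(v_x)_{x\in X}\big)\in\prod_{y\in Y}\Gamma_\tau(\mathcal A_{Y,y})\times\prod_{x\in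 X}\Gamma_\tau(\mathcal A_{X,x}):(w_{\varphi(x)},v_x)\in\Gamma_\tau(\Phi_x)\ \forall x\in X\Big\}.$$
   Context: $\tau:\mathcal T\Rightarrow\mathcal U$ is $\mathsf D$-fibered if every component $\tau_c:\mathcal T c\to\mathcal U c$ is a split epimorphism in $\mathsf D$. $\mathrm{Arrow}(\mathsf C)$ is the arrow category of $\mathsf C$ (objects: morphisms of $\mathsf C$; morphisms: commuting squares), with monoidal product $p\otimes q$ and unit $\mathrm{id}_{1_{\mathsf C}}$ induced from $\mathsf C$. A subcategory $\mathsf A$ is cartesian monoidal if it is closed under this structure, $\otimes$ is a categorical product in $\mathsf A$, and the monoidal unit is terminal in $\mathsf A$ (and the projections are the standard ones of a cartesian monoidal category). An object of $\mathsf A$ is written $a=(p_a:a_{tot}\to a_{st})$ and a morphism $f:a\to b$ as a pair $(f_{tot},f_{st})$. Open sections: $\Gamma_\tau(a)=\{X:\mathcal U a_{tot}\to\mathcal T a_{st}\text{ in }\mathsf D:\ \tau_{a_{st}}\circ X=\mathcal U p_a\}$. For $f:a\to b$ in $\mathsf A$, $X\in\Gamma_\tau(a)$ and $Y\in\Gamma_\tau(b)$ are $f$-related if $\mathcal T f_{st}\circ X=Y\circ\mathcal U f_{tot}$, and $\Gamma_\tau(f)\subseteq\Gamma_\tau(a)\times\Gamma_\tau(b)$ is the relation of $f$-related pairs. A morphism $i:a\to b$ in $\mathsf A$ is an interconnection if $i_{st}$ is an isomorphism in $\mathsf C$; then $\Gamma_\tau(i)$ also denotes the function $\Gamma_\tau(b)\to\Gamma_\tau(a)$,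 $Y\mapsto(\mathcal T i_{st})^{-1}\circ Y\circ\mathcal U i_{tot}$ (used for the vertical arrows). Lists: an object of $(\mathsf{FinSet}/\mathsf A)^\Leftarrow$ is a finite family $\mathcal A_X=\{\mathcal A_{X,x}\}_{x\in X}$ of objects of $\mathsf A$; a morphism $(\varphi,\Phi):\mathcal A_X\to\mathcal A_Y$ is a map of sets $\varphi:X\to Y$ with morphisms $\Phi_x:\mathcal A_{Y,\varphi(x)}\to\mathcal A_{X,x}$ in $\mathsf A$. $\Pi(\mathcal A_X)=\bigotimes_{x\in X}\mathcal A_{X,x}$, and $\Pi(\varphi,\Phi):\Pi(\mathcal A_Y)\to\Pi(\mathcal A_X)$ is the unique morphism with $\mathrm{pr}_x\circ\Pi(\varphi,\Phi)=\Phi_x\circ\mathrm{pr}_{\varphi(x)}$ for all $x\in X$. A network of $\mathsf A$-open $\tau$-systems is a pair $(\mathcal A_X,\iota_X:a\to\Pi(\mathcal A_X))$ with $\mathcal A_X$ a list and $\iota_X$ an interconnection. A morphism $((\varphi,\Phi),f):(\mathcal A_X,\iota_X:a\to\Pi(\mathcal A_X))\to(\mathcal A_Y,\iota_Y:a'\to\Pi(\mathcal A_Y))$ consists of a morphism of lists $(\varphi,\Phi):\mathcal A_X\to\mathcal A_Y$ and a morphism $f:a'\to a$ in $\mathsf A$ with $\iota_X\circ f=\Pi(\varphi,\Phi)\circ\iota_Y$. $\mathscr P_X:\prod_{x\in X}\Gamma_\tau(\mathcal A_{X,x})\to\Gamma_\tau(\Pi(\mathcal A_X))$ sends $(v_x)_x$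 to the composite $\mathcal U(\bigotimes_x\mathcal A_{x,tot})\cong\bigotimes_x\mathcal U\mathcal A_{x,tot}\xrightarrow{\bigotimes v_x}\bigotimes_x\mathcal T\mathcal A_{x,st}\cong\mathcal T(\bigotimes_x\mathcal A_{x,st})$, the isomorphisms being the strong monoidal structure maps of $\mathcal U$ and $\mathcal T$. $\mathsf{Set}^\square$ is the double category of sets, with functions as vertical arrows and relations as horizontal arrows; a 1-morphism from $R\subseteq A\times B$ to $R'\subseteq A'\times B'$ along functions $g:A\to A'$, $h:B\to B'$ is the inclusion $(g\times h)(R)\subseteq R'$. *)

theory Defs
  imports "HOL-Library.FuncSet"
begin

section \<open>Categories\<close>

text \<open>
  Objects and arrows are carved out of types by carrier sets, so hom-collections are sets and
  every category below is locally small. Composition is written in the usual order, first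
  the right-hand arrow, then the left-hand one.
\<close>

record ('o, 'm) cat =
  Obj :: "'o set"
  Arr :: "'m set"
  Dom :: "'m \<Rightarrow> 'o"
  Cod :: "'m \<Rightarrow> 'o"
  Ident :: "'o \<Rightarrow> 'm"
  Comp :: "'m \<Rightarrow> 'm \<Rightarrow> 'm" (infixl "\<cdot>\<index>" 65)

definition hom :: "('o, 'm, 'z) cat_scheme \<Rightarrow> 'o \<Rightarrow> 'o \<Rightarrow> 'm set" where
  "hom C a b = {f \<in> Arr C. Dom C f = a \<and> Cod C f = b}"

locale category =
  fixes C :: "('o, 'm, 'z) cat_scheme" (structure)
  assumes dom_obj: "f \<in> Arr C \<Longrightarrow> Dom C f \<in> Obj C"
    and cod_obj: "f \<in> Arr C \<Longrightarrow> Cod C f \<in> Obj C"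
    and id_hom: "a \<in> Obj C \<Longrightarrow> Ident C a \<in> hom C a a"
    and comp_hom: "\<lbrakk>f \<in> hom C a b; g \<in> hom C b c\<rbrakk> \<Longrightarrow> g \<cdot> f \<in> hom C a c"
    and comp_id_left: "f \<in> hom C a b \<Longrightarrow> Ident C b \<cdot> f = f"
    and comp_id_right: "f \<in> hom C a b \<Longrightarrow> f \<cdot> Ident C a = f"
    and comp_assoc: "\<lbrakk>f \<in> hom C a b; g \<in> hom C b c; h \<in> hom C c d\<rbrakk>
      \<Longrightarrow> (h \<cdot> g) \<cdot> f = h \<cdot> (g \<cdot> f)"

definition inverse_arrows :: "('o, 'm, 'z) cat_scheme \<Rightarrow> 'm \<Rightarrow> 'm \<Rightarrow> bool" where
  "inverse_arrows C f g \<longleftrightarrow> f \<in> Arr C \<and> g \<in> hom C (Cod C f) (Dom C f) \<and>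
     g \<cdot>\<^bsub>C\<^esub> f = Ident C (Dom C f) \<and> f \<cdot>\<^bsub>C\<^esub> g = Ident C (Cod C f)"

definition is_iso :: "('o, 'm, 'z) cat_scheme \<Rightarrow> 'm \<Rightarrow> bool" where
  "is_iso C f \<longleftrightarrow> (\<exists>g. inverse_arrows C f g)"

definition inv_arr :: "('o, 'm, 'z) cat_scheme \<Rightarrow> 'm \<Rightarrow> 'm" where
  "inv_arr C f = (THE g. inverse_arrows C f g)"

definition split_epi :: "('o, 'm, 'z) cat_scheme \<Rightarrow> 'm \<Rightarrow> bool" where
  "split_epi C f \<longleftrightarrow>
     f \<in> Arr C \<and> (\<exists>s \<in> hom C (Cod C f) (Dom C f). f \<cdot>\<^bsub>C\<^esub> s = Ident C (Cod C f))"

definition is_terminal :: "('o, 'm, 'z) cat_scheme \<Rightarrow> 'o \<Rightarrow> bool" where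
  "is_terminal C t \<longleftrightarrow> t \<in> Obj C \<and> (\<forall>a \<in> Obj C. \<exists>!f. f \<in> hom C a t)"

definition is_product :: "('o, 'm, 'z) cat_scheme \<Rightarrow> 'o \<Rightarrow> 'o \<Rightarrow> 'o \<Rightarrow> 'm \<Rightarrow> 'm \<Rightarrow> bool" where
  "is_product C a b p \<pi>\<^sub>1 \<pi>\<^sub>2 \<longleftrightarrow> \<pi>\<^sub>1 \<in> hom C p a \<and> \<pi>\<^sub>2 \<in> hom C p b \<and>
     (\<forall>c \<in> Obj C. \<forall>f \<in> hom C c a. \<forall>g \<in> hom C c b.
        \<exists>!h. h \<in> hom C c p \<and> \<pi>\<^sub>1 \<cdot>\<^bsub>C\<^esub> h = f \<and> \<pi>\<^sub>2 \<cdot>\<^bsub>C\<^esub> h = g)"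


section \<open>Functors and concrete categories\<close>

record ('o, 'm, 'p, 'n) func =
  fobj :: "'o \<Rightarrow> 'p"
  farr :: "'m \<Rightarrow> 'n"

locale cat_functor = C: category C + D: category D
  for C :: "('o, 'm, 'y) cat_scheme" and D :: "('p, 'n, 'z) cat_scheme" +
  fixes F :: "('o, 'm, 'p, 'n, 'w) func_scheme"
  assumes fobj_obj: "a \<in> Obj C \<Longrightarrow> fobj F a \<in> Obj D"
    and farr_hom: "f \<in> hom C a b \<Longrightarrow> farr F f \<in> hom D (fobj F a) (fobj F b)"
    and farr_id: "a \<in> Obj C \<Longrightarrow> farr F (Ident C a) = Ident D (fobj F a)"
    and farr_comp: "\<lbrakk>f \<in> hom C a b; g \<in> hom C b c\<rbrakk>
      \<Longrightarrow> farr F (g \<cdot>\<^bsub>C\<^esub> f) = farr F g \<cdot>\<^bsub>D\<^esub> farr F f"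

definition faithful :: "('o, 'm, 'z) cat_scheme \<Rightarrow> ('o, 'm, 'p, 'n, 'w) func_scheme \<Rightarrow> bool" where
  "faithful C F \<longleftrightarrow> (\<forall>a \<in> Obj C. \<forall>b \<in> Obj C. inj_on (farr F) (hom C a b))"

text \<open>The category of sets (of elements of a type) and functions.\<close>

definition set_cat :: "('u set, 'u set \<times> ('u \<Rightarrow> 'u) \<times> 'u set) cat" where
  "set_cat =
    \<lparr> Obj = UNIV,
      Arr = {(A, f, B). f \<in> A \<rightarrow>\<^sub>E B},
      Dom = (\<lambda>(A, f, B). A),
      Cod = (\<lambda>(A, f, B). B),
      Ident = (\<lambda>A. (A, \<lambda>x\<in>A. x, A)),
      Comp = (\<lambda>(B, g, C) (A, f, B'). (A, compose A g f, C)) \<rparr>"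

text \<open>A concrete category comes with a faithful functor \<open>K\<close> to the category of sets.\<close>

definition concrete_category ::
  "('o, 'm, 'z) cat_scheme \<Rightarrow>
   ('o, 'm, 'u set, 'u set \<times> ('u \<Rightarrow> 'u) \<times> 'u set) func \<Rightarrow> bool" where
  "concrete_category C K \<longleftrightarrow> cat_functor C set_cat K \<and> faithful C K"


section \<open>Monoidal and cartesian monoidal categories\<close>

record ('o, 'm) moncat = "('o, 'm) cat" +
  tens_obj :: "'o \<Rightarrow> 'o \<Rightarrow> 'o" (infixr "\<otimes>\<^sub>o\<index>" 70)
  tens_arr :: "'m \<Rightarrow> 'm \<Rightarrow> 'm" (infixr "\<otimes>\<index>" 70)
  unit_obj :: "'o" ("\<one>\<index>")
  assoc :: "'o \<Rightarrow> 'o \<Rightarrow> 'o \<Rightarrow> 'm"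
  lunit :: "'o \<Rightarrow> 'm"
  runit :: "'o \<Rightarrow> 'm"

locale monoidal_category = category C
  for C :: "('o, 'm, 'z) moncat_scheme" (structure) +
  assumes tens_obj_obj: "\<lbrakk>a \<in> Obj C; b \<in> Obj C\<rbrakk> \<Longrightarrow> a \<otimes>\<^sub>o b \<in> Obj C"
    and tens_arr_hom: "\<lbrakk>f \<in> hom C a b; g \<in> hom C c d\<rbrakk> \<Longrightarrow> f \<otimes> g \<in> hom C (a \<otimes>\<^sub>o c) (b \<otimes>\<^sub>o d)"
    and tens_id: "\<lbrakk>a \<in> Obj C; b \<in> Obj C\<rbrakk> \<Longrightarrow> Ident C a \<otimes> Ident C b = Ident C (a \<otimes>\<^sub>o b)"
    and tens_comp: "\<lbrakk>f \<in> hom C a b; g \<in> hom C b c; f' \<in> hom C a' b'; g' \<in> hom C b' c'\<rbrakk>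
      \<Longrightarrow> (g \<cdot> f) \<otimes> (g' \<cdot> f') = (g \<otimes> g') \<cdot> (f \<otimes> f')"
    and unit_obj_obj: "\<one> \<in> Obj C"
    and assoc_hom: "\<lbrakk>a \<in> Obj C; b \<in> Obj C; c \<in> Obj C\<rbrakk>
      \<Longrightarrow> assoc C a b c \<in> hom C ((a \<otimes>\<^sub>o b) \<otimes>\<^sub>o c) (a \<otimes>\<^sub>o (b \<otimes>\<^sub>o c))"
    and assoc_iso: "\<lbrakk>a \<in> Obj C; b \<in> Obj C; c \<in> Obj C\<rbrakk> \<Longrightarrow> is_iso C (assoc C a b c)"
    and assoc_nat: "\<lbrakk>f \<in> hom C a a'; g \<in> hom C b b'; h \<in> hom C c c'\<rbrakk>
      \<Longrightarrow> assoc C a' b' c' \<cdot> ((f \<otimes> g) \<otimes> h) = (f \<otimes> (g \<otimes> h)) \<cdot> assoc C a b c"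
    and lunit_hom: "a \<in> Obj C \<Longrightarrow> lunit C a \<in> hom C (\<one> \<otimes>\<^sub>o a) a"
    and lunit_iso: "a \<in> Obj C \<Longrightarrow> is_iso C (lunit C a)"
    and lunit_nat: "f \<in> hom C a b \<Longrightarrow> lunit C b \<cdot> (Ident C \<one> \<otimes> f) = f \<cdot> lunit C a"
    and runit_hom: "a \<in> Obj C \<Longrightarrow> runit C a \<in> hom C (a \<otimes>\<^sub>o \<one>) a"
    and runit_iso: "a \<in> Obj C \<Longrightarrow> is_iso C (runit C a)"
    and runit_nat: "f \<in> hom C a b \<Longrightarrow> runit C b \<cdot> (f \<otimes> Ident C \<one>) = f \<cdot> runit C a"
    and pentagon: "\<lbrakk>a \<in> Obj C; b \<in> Obj C; c \<in> Obj C; d \<in> Obj C\<rbrakk>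
      \<Longrightarrow> (Ident C a \<otimes> assoc C b c d) \<cdot> assoc C a (b \<otimes>\<^sub>o c) d \<cdot> (assoc C a b c \<otimes> Ident C d)
        = assoc C a b (c \<otimes>\<^sub>o d) \<cdot> assoc C (a \<otimes>\<^sub>o b) c d"
    and triangle: "\<lbrakk>a \<in> Obj C; b \<in> Obj C\<rbrakk>
      \<Longrightarrow> (Ident C a \<otimes> lunit C b) \<cdot> assoc C a \<one> b = runit C a \<otimes> Ident C b"

text \<open>
  When the monoidal unit is terminal, the standard projections discard one tensor factor and
  then remove the unit.
\<close>

definition discard :: "('o, 'm, 'z) moncat_scheme \<Rightarrow> 'o \<Rightarrow> 'm" where
  "discard C a = (THE f. f \<in> hom C a \<one>\<^bsub>C\<^esub>)"

definition proj\<^sub>1 :: "('o, 'm, 'z) moncat_scheme \<Rightarrow> 'o \<Rightarrow> 'o \<Rightarrow> 'm" where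
  "proj\<^sub>1 C a b = runit C a \<cdot>\<^bsub>C\<^esub> (Ident C a \<otimes>\<^bsub>C\<^esub> discard C b)"

definition proj\<^sub>2 :: "('o, 'm, 'z) moncat_scheme \<Rightarrow> 'o \<Rightarrow> 'o \<Rightarrow> 'm" where
  "proj\<^sub>2 C a b = lunit C b \<cdot>\<^bsub>C\<^esub> (discard C a \<otimes>\<^bsub>C\<^esub> Ident C b)"

locale cartesian_monoidal_category = monoidal_category C
  for C :: "('o, 'm, 'z) moncat_scheme" (structure) +
  assumes unit_terminal: "is_terminal C \<one>"
    and tens_product: "\<lbrakk>a \<in> Obj C; b \<in> Obj C\<rbrakk>
      \<Longrightarrow> is_product C a b (a \<otimes>\<^sub>o b) (proj\<^sub>1 C a b) (proj\<^sub>2 C a b)"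

text \<open>
  A tensor product over a finite index set needs an ordering of the indices; it is given here by
  the list of indices, and brackets are to the right: \<open>\<Otimes>[x\<^sub>1, \<dots>, x\<^sub>n]\<close> is
  \<open>A x\<^sub>1 \<otimes> (\<dots> \<otimes> (A x\<^sub>n \<otimes> \<one>))\<close>.
\<close>

primrec bigtens_obj :: "('o, 'm, 'z) moncat_scheme \<Rightarrow> ('x \<Rightarrow> 'o) \<Rightarrow> 'x list \<Rightarrow> 'o" where
  "bigtens_obj C A [] = \<one>\<^bsub>C\<^esub>"
| "bigtens_obj C A (x # xs) = A x \<otimes>\<^sub>o\<^bsub>C\<^esub> bigtens_obj C A xs"

primrec bigtens_arr :: "('o, 'm, 'z) moncat_scheme \<Rightarrow> ('x \<Rightarrow> 'm) \<Rightarrow> 'x list \<Rightarrow> 'm" where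
  "bigtens_arr C f [] = Ident C \<one>\<^bsub>C\<^esub>"
| "bigtens_arr C f (x # xs) = f x \<otimes>\<^bsub>C\<^esub> bigtens_arr C f xs"

primrec bigproj :: "('o, 'm, 'z) moncat_scheme \<Rightarrow> ('x \<Rightarrow> 'o) \<Rightarrow> 'x list \<Rightarrow> 'x \<Rightarrow> 'm" where
  "bigproj C A [] z = undefined"
| "bigproj C A (x # xs) z =
     (if z = x then proj\<^sub>1 C (A x) (bigtens_obj C A xs)
      else bigproj C A xs z \<cdot>\<^bsub>C\<^esub> proj\<^sub>2 C (A x) (bigtens_obj C A xs))"


section \<open>Strong monoidal functors and monoidal natural transformations\<close>

record ('o, 'm, 'p, 'n) monfun = "('o, 'm, 'p, 'n) func" +
  fmult :: "'o \<Rightarrow> 'o \<Rightarrow> 'n"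
  funit :: "'n"

locale strong_monoidal_functor =
  C: monoidal_category C + D: monoidal_category D + cat_functor C D F
  for C :: "('o, 'm, 'y) moncat_scheme" and D :: "('p, 'n, 'z) moncat_scheme"
    and F :: "('o, 'm, 'p, 'n, 'w) monfun_scheme" +
  assumes fmult_hom: "\<lbrakk>a \<in> Obj C; b \<in> Obj C\<rbrakk>
      \<Longrightarrow> fmult F a b \<in> hom D (fobj F a \<otimes>\<^sub>o\<^bsub>D\<^esub> fobj F b) (fobj F (a \<otimes>\<^sub>o\<^bsub>C\<^esub> b))"
    and fmult_iso: "\<lbrakk>a \<in> Obj C; b \<in> Obj C\<rbrakk> \<Longrightarrow> is_iso D (fmult F a b)"
    and fmult_nat: "\<lbrakk>f \<in> hom C a a'; g \<in> hom C b b'\<rbrakk>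
      \<Longrightarrow> fmult F a' b' \<cdot>\<^bsub>D\<^esub> (farr F f \<otimes>\<^bsub>D\<^esub> farr F g) = farr F (f \<otimes>\<^bsub>C\<^esub> g) \<cdot>\<^bsub>D\<^esub> fmult F a b"
    and funit_hom: "funit F \<in> hom D \<one>\<^bsub>D\<^esub> (fobj F \<one>\<^bsub>C\<^esub>)"
    and funit_iso: "is_iso D (funit F)"
    and fmult_assoc: "\<lbrakk>a \<in> Obj C; b \<in> Obj C; c \<in> Obj C\<rbrakk>
      \<Longrightarrow> farr F (assoc C a b c) \<cdot>\<^bsub>D\<^esub> fmult F (a \<otimes>\<^sub>o\<^bsub>C\<^esub> b) c
            \<cdot>\<^bsub>D\<^esub> (fmult F a b \<otimes>\<^bsub>D\<^esub> Ident D (fobj F c))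
        = fmult F a (b \<otimes>\<^sub>o\<^bsub>C\<^esub> c) \<cdot>\<^bsub>D\<^esub> (Ident D (fobj F a) \<otimes>\<^bsub>D\<^esub> fmult F b c)
            \<cdot>\<^bsub>D\<^esub> assoc D (fobj F a) (fobj F b) (fobj F c)"
    and fmult_lunit: "a \<in> Obj C
      \<Longrightarrow> farr F (lunit C a) \<cdot>\<^bsub>D\<^esub> fmult F \<one>\<^bsub>C\<^esub> a \<cdot>\<^bsub>D\<^esub> (funit F \<otimes>\<^bsub>D\<^esub> Ident D (fobj F a))
        = lunit D (fobj F a)"
    and fmult_runit: "a \<in> Obj C
      \<Longrightarrow> farr F (runit C a) \<cdot>\<^bsub>D\<^esub> fmult F a \<one>\<^bsub>C\<^esub> \<cdot>\<^bsub>D\<^esub> (Ident D (fobj F a) \<otimes>\<^bsub>D\<^esub> funit F)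
        = runit D (fobj F a)"

text \<open>The iterated structure map \<open>\<Otimes> F (A x) \<rightarrow> F (\<Otimes> A x)\<close>.\<close>

primrec bigmult ::
  "('o, 'm, 'y) moncat_scheme \<Rightarrow> ('p, 'n, 'z) moncat_scheme \<Rightarrow>
   ('o, 'm, 'p, 'n, 'w) monfun_scheme \<Rightarrow> ('x \<Rightarrow> 'o) \<Rightarrow> 'x list \<Rightarrow> 'n" where
  "bigmult C D F A [] = funit F"
| "bigmult C D F A (x # xs) =
     fmult F (A x) (bigtens_obj C A xs) \<cdot>\<^bsub>D\<^esub> (Ident D (fobj F (A x)) \<otimes>\<^bsub>D\<^esub> bigmult C D F A xs)"

locale monoidal_nat_trans =
  T: strong_monoidal_functor C D T + U: strong_monoidal_functor C D U
  for C :: "('o, 'm, 'y) moncat_scheme" and D :: "('p, 'n, 'z) moncat_scheme"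
    and T :: "('o, 'm, 'p, 'n, 'v) monfun_scheme"
    and U :: "('o, 'm, 'p, 'n, 'w) monfun_scheme" +
  fixes \<tau> :: "'o \<Rightarrow> 'n"
  assumes comp_hom: "c \<in> Obj C \<Longrightarrow> \<tau> c \<in> hom D (fobj T c) (fobj U c)"
    and naturality: "f \<in> hom C a b \<Longrightarrow> \<tau> b \<cdot>\<^bsub>D\<^esub> farr T f = farr U f \<cdot>\<^bsub>D\<^esub> \<tau> a"
    and mult_compat: "\<lbrakk>a \<in> Obj C; b \<in> Obj C\<rbrakk>
      \<Longrightarrow> \<tau> (a \<otimes>\<^sub>o\<^bsub>C\<^esub> b) \<cdot>\<^bsub>D\<^esub> fmult T a b = fmult U a b \<cdot>\<^bsub>D\<^esub> (\<tau> a \<otimes>\<^bsub>D\<^esub> \<tau> b)"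
    and unit_compat: "\<tau> \<one>\<^bsub>C\<^esub> \<cdot>\<^bsub>D\<^esub> funit T = funit U"

definition fibered ::
  "('o, 'm, 'y) cat_scheme \<Rightarrow> ('p, 'n, 'z) cat_scheme \<Rightarrow> ('o \<Rightarrow> 'n) \<Rightarrow> bool" where
  "fibered C D \<tau> \<longleftrightarrow> (\<forall>c \<in> Obj C. split_epi D (\<tau> c))"


section \<open>The arrow category and its cartesian monoidal subcategories\<close>

text \<open>
  A morphism \<open>(f\<^sub>t\<^sub>o\<^sub>t, f\<^sub>s\<^sub>t)\<close> from \<open>p\<close> to \<open>q\<close> is recorded together with its domain and codomain
  as \<open>Square p f\<^sub>t\<^sub>o\<^sub>t f\<^sub>s\<^sub>t q\<close>. For an object \<open>p\<close> of the arrow category, \<open>p\<^sub>t\<^sub>o\<^sub>t\<close> is \<open>Dom C p\<close> and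
  \<open>p\<^sub>s\<^sub>t\<close> is \<open>Cod C p\<close>.
\<close>

datatype 'm square = Square (sq_dom: 'm) (tot: 'm) (st: 'm) (sq_cod: 'm)

definition arrow_cat :: "('o, 'm, 'z) moncat_scheme \<Rightarrow> ('m, 'm square) moncat" where
  "arrow_cat C =
    \<lparr> Obj = Arr C,
      Arr = {Square p f g q | p f g q.
        p \<in> Arr C \<and> q \<in> Arr C \<and> f \<in> hom C (Dom C p) (Dom C q) \<and> g \<in> hom C (Cod C p) (Cod C q) \<and>
        q \<cdot>\<^bsub>C\<^esub> f = g \<cdot>\<^bsub>C\<^esub> p},
      Dom = sq_dom,
      Cod = sq_cod,
      Ident = (\<lambda>p. Square p (Ident C (Dom C p)) (Ident C (Cod C p)) p),
      Comp = (\<lambda>s t. Square (sq_dom t) (tot s \<cdot>\<^bsub>C\<^esub> tot t) (st s \<cdot>\<^bsub>C\<^esub> st t) (sq_cod s)),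
      tens_obj = (\<lambda>p q. p \<otimes>\<^bsub>C\<^esub> q),
      tens_arr = (\<lambda>s t. Square (sq_dom s \<otimes>\<^bsub>C\<^esub> sq_dom t) (tot s \<otimes>\<^bsub>C\<^esub> tot t)
                               (st s \<otimes>\<^bsub>C\<^esub> st t) (sq_cod s \<otimes>\<^bsub>C\<^esub> sq_cod t)),
      unit_obj = Ident C \<one>\<^bsub>C\<^esub>,
      assoc = (\<lambda>p q r. Square ((p \<otimes>\<^bsub>C\<^esub> q) \<otimes>\<^bsub>C\<^esub> r)
                (assoc C (Dom C p) (Dom C q) (Dom C r)) (assoc C (Cod C p) (Cod C q) (Cod C r))
                (p \<otimes>\<^bsub>C\<^esub> (q \<otimes>\<^bsub>C\<^esub> r))),
      lunit = (\<lambda>p. Square (Ident C \<one>\<^bsub>C\<^esub> \<otimes>\<^bsub>C\<^esub> p) (lunit C (Dom C p)) (lunit C (Cod C p)) p),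
      runit = (\<lambda>p. Square (p \<otimes>\<^bsub>C\<^esub> Ident C \<one>\<^bsub>C\<^esub>) (runit C (Dom C p)) (runit C (Cod C p)) p) \<rparr>"

text \<open>
  The operations of a subcategory are those of the ambient category, and only the carriers shrink.
  Closure under the category and monoidal structure, including the structure isomorphisms and their
  inverses, is expressed by the axioms holding for the smaller carriers.
\<close>

definition cartesian_monoidal_subcategory ::
  "('o, 'm) moncat \<Rightarrow> ('o, 'm) moncat \<Rightarrow> bool" where
  "cartesian_monoidal_subcategory A B \<longleftrightarrow>
     A = B\<lparr>Obj := Obj A, Arr := Arr A\<rparr> \<and> Obj A \<subseteq> Obj B \<and> Arr A \<subseteq> Arr B \<and>
     cartesian_monoidal_category A"


section \<open>Open sections and interconnections\<close>

definition sections ::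
  "('o, 'm) moncat \<Rightarrow> ('p, 'n) moncat \<Rightarrow> ('o, 'm, 'p, 'n) monfun \<Rightarrow> ('o, 'm, 'p, 'n) monfun \<Rightarrow>
   ('o \<Rightarrow> 'n) \<Rightarrow> 'm \<Rightarrow> 'n set" where
  "sections C D T U \<tau> a =
     {X \<in> hom D (fobj U (Dom C a)) (fobj T (Cod C a)). \<tau> (Cod C a) \<cdot>\<^bsub>D\<^esub> X = farr U a}"

definition sections_rel ::
  "('o, 'm) moncat \<Rightarrow> ('p, 'n) moncat \<Rightarrow> ('o, 'm, 'p, 'n) monfun \<Rightarrow> ('o, 'm, 'p, 'n) monfun \<Rightarrow>
   ('o \<Rightarrow> 'n) \<Rightarrow> 'm square \<Rightarrow> ('n \<times> 'n) set" where
  "sections_rel C D T U \<tau> f =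
     {(X, Y). X \<in> sections C D T U \<tau> (sq_dom f) \<and> Y \<in> sections C D T U \<tau> (sq_cod f) \<and>
              farr T (st f) \<cdot>\<^bsub>D\<^esub> X = Y \<cdot>\<^bsub>D\<^esub> farr U (tot f)}"

definition interconnection ::
  "('o, 'm) moncat \<Rightarrow> ('m, 'm square) moncat \<Rightarrow> 'm \<Rightarrow> 'm \<Rightarrow> 'm square \<Rightarrow> bool" where
  "interconnection C A a b i \<longleftrightarrow> i \<in> hom A a b \<and> is_iso C (st i)"

text \<open>The function \<open>\<Gamma>\<^sub>\<tau>(b) \<rightarrow> \<Gamma>\<^sub>\<tau>(a)\<close> induced by an interconnection \<open>i : a \<rightarrow> b\<close>.\<close>

definition sections_map ::
  "('p, 'n) moncat \<Rightarrow> ('o, 'm, 'p, 'n) monfun \<Rightarrow> ('o, 'm, 'p, 'n) monfun \<Rightarrow> 'm square \<Rightarrow> 'n \<Rightarrow> 'n"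
  where
  "sections_map D T U i Y = inv_arr D (farr T (st i)) \<cdot>\<^bsub>D\<^esub> Y \<cdot>\<^bsub>D\<^esub> farr U (tot i)"


section \<open>Lists and networks\<close>

text \<open>
  A finite family of objects; its index set is the set of entries of \<open>enum\<close>. The enumeration
  only serves to order and bracket the tensor product, and maps of index sets ignore it.
\<close>

record ('x, 'a) family =
  enum :: "'x list"
  memb :: "'x \<Rightarrow> 'a"

definition idx :: "('x, 'a) family \<Rightarrow> 'x set" where
  "idx F = set (enum F)"

definition is_list :: "('a, 's) moncat \<Rightarrow> ('x, 'a) family \<Rightarrow> bool" where
  "is_list A F \<longleftrightarrow> distinct (enum F) \<and> (\<forall>x \<in> idx F. memb F x \<in> Obj A)"

definition list_morphism ::
  "('a, 's) moncat \<Rightarrow> ('x, 'a) family \<Rightarrow> ('y, 'a) family \<Rightarrow> ('x \<Rightarrow> 'y) \<Rightarrow> ('x \<Rightarrow> 's) \<Rightarrow> bool" where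
  "list_morphism A F G \<phi> \<Phi> \<longleftrightarrow> is_list A F \<and> is_list A G \<and>
     \<phi> \<in> idx F \<rightarrow> idx G \<and> (\<forall>x \<in> idx F. \<Phi> x \<in> hom A (memb G (\<phi> x)) (memb F x))"

definition list_prod :: "('a, 's) moncat \<Rightarrow> ('x, 'a) family \<Rightarrow> 'a" where
  "list_prod A F = bigtens_obj A (memb F) (enum F)"

definition list_proj :: "('a, 's) moncat \<Rightarrow> ('x, 'a) family \<Rightarrow> 'x \<Rightarrow> 's" where
  "list_proj A F x = bigproj A (memb F) (enum F) x"

definition list_prod_map ::
  "('a, 's) moncat \<Rightarrow> ('x, 'a) family \<Rightarrow> ('y, 'a) family \<Rightarrow> ('x \<Rightarrow> 'y) \<Rightarrow> ('x \<Rightarrow> 's) \<Rightarrow> 's" where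
  "list_prod_map A F G \<phi> \<Phi> =
     (THE h. h \<in> hom A (list_prod A G) (list_prod A F) \<and>
        (\<forall>x \<in> idx F. list_proj A F x \<cdot>\<^bsub>A\<^esub> h = \<Phi> x \<cdot>\<^bsub>A\<^esub> list_proj A G (\<phi> x)))"

definition network ::
  "('o, 'm) moncat \<Rightarrow> ('m, 'm square) moncat \<Rightarrow> ('x, 'm) family \<Rightarrow> 'm \<Rightarrow> 'm square \<Rightarrow> bool" where
  "network C A F a i \<longleftrightarrow> is_list A F \<and> interconnection C A a (list_prod A F) i"

definition network_morphism ::
  "('o, 'm) moncat \<Rightarrow> ('m, 'm square) moncat \<Rightarrow>
   ('x, 'm) family \<Rightarrow> 'm \<Rightarrow> 'm square \<Rightarrow> ('y, 'm) family \<Rightarrow> 'm \<Rightarrow> 'm square \<Rightarrow>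
   ('x \<Rightarrow> 'y) \<Rightarrow> ('x \<Rightarrow> 'm square) \<Rightarrow> 'm square \<Rightarrow> bool" where
  "network_morphism C A F a i G a' i' \<phi> \<Phi> f \<longleftrightarrow>
     network C A F a i \<and> network C A G a' i' \<and> list_morphism A F G \<phi> \<Phi> \<and>
     f \<in> hom A a' a \<and> i \<cdot>\<^bsub>A\<^esub> f = list_prod_map A F G \<phi> \<Phi> \<cdot>\<^bsub>A\<^esub> i'"

definition sections_prod ::
  "('o, 'm) moncat \<Rightarrow> ('p, 'n) moncat \<Rightarrow> ('o, 'm, 'p, 'n) monfun \<Rightarrow> ('o, 'm, 'p, 'n) monfun \<Rightarrow>
   ('o \<Rightarrow> 'n) \<Rightarrow> ('x, 'm) family \<Rightarrow> ('x \<Rightarrow> 'n) set" where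
  "sections_prod C D T U \<tau> F = (\<Pi>\<^sub>E x \<in> idx F. sections C D T U \<tau> (memb F x))"

text \<open>
  The relation \<open>\<Gamma>\<^sub>\<tau>(\<phi>, \<Phi>)\<close>; it goes from the sections over \<open>G\<close> to those over \<open>F\<close>, against the
  direction of \<open>\<phi>\<close>.
\<close>

definition sections_list_rel ::
  "('o, 'm) moncat \<Rightarrow> ('p, 'n) moncat \<Rightarrow> ('o, 'm, 'p, 'n) monfun \<Rightarrow> ('o, 'm, 'p, 'n) monfun \<Rightarrow>
   ('o \<Rightarrow> 'n) \<Rightarrow> ('x, 'm) family \<Rightarrow> ('y, 'm) family \<Rightarrow> ('x \<Rightarrow> 'y) \<Rightarrow> ('x \<Rightarrow> 'm square) \<Rightarrow>
   (('y \<Rightarrow> 'n) \<times> ('x \<Rightarrow> 'n)) set" where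
  "sections_list_rel C D T U \<tau> F G \<phi> \<Phi> =
     {(w, v) \<in> sections_prod C D T U \<tau> G \<times> sections_prod C D T U \<tau> F.
        \<forall>x \<in> idx F. (w (\<phi> x), v x) \<in> sections_rel C D T U \<tau> (\<Phi> x)}"

text \<open>The map \<open>\<P>\<close> from a product of sections to sections of the product.\<close>

definition parallel ::
  "('o, 'm) moncat \<Rightarrow> ('p, 'n) moncat \<Rightarrow> ('o, 'm, 'p, 'n) monfun \<Rightarrow> ('o, 'm, 'p, 'n) monfun \<Rightarrow>
   ('x, 'm) family \<Rightarrow> ('x \<Rightarrow> 'n) \<Rightarrow> 'n" where
  "parallel C D T U F v =
     bigmult C D T (\<lambda>x. Cod C (memb F x)) (enum F)
       \<cdot>\<^bsub>D\<^esub> bigtens_arr D v (enum F)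
       \<cdot>\<^bsub>D\<^esub> inv_arr D (bigmult C D U (\<lambda>x. Dom C (memb F x)) (enum F))"


section \<open>The double category of sets, functions and relations\<close>

text \<open>
  The 1-morphism from the relation \<open>R \<subseteq> A \<times> B\<close> to the relation \<open>R' \<subseteq> A' \<times> B'\<close> along functions
  \<open>g : A \<rightarrow> A'\<close> and \<open>h : B \<rightarrow> B'\<close>.
\<close>

definition relation_square ::
  "'a set \<Rightarrow> 'b set \<Rightarrow> ('a \<times> 'b) set \<Rightarrow> 'c set \<Rightarrow> 'd set \<Rightarrow> ('c \<times> 'd) set \<Rightarrow>
   ('a \<Rightarrow> 'c) \<Rightarrow> ('b \<Rightarrow> 'd) \<Rightarrow> bool" where
  "relation_square A B R A' B' R' g h \<longleftrightarrow>
     R \<subseteq> A \<times> B \<and> R' \<subseteq> A' \<times> B' \<and> g \<in> A \<rightarrow> A' \<and> h \<in> B \<rightarrow> B' \<and> map_prod g h ` R \<subseteq> R'"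

end

theory Submission
  imports Defs
begin

text \<open>
  Taking total or state components turns \<open>U\<close> and \<open>T\<close> into strong monoidal functors from \<open>A\<close> to \<open>D\<close>.
  A strong monoidal functor between cartesian monoidal categories carries projections to projections,
  because its unit comparison is an isomorphism onto a terminal object. Hence \<open>T\<close> applied to
  the state parts of the projections of \<open>\<Pi>\<close> is a jointly monic family, and \<open>\<P> v\<close> followed by the \<open>x\<close>-th
  member of it is \<open>v x\<close> after the \<open>x\<close>-th total projection. Testing against these projections,
  relatedness of the components along \<open>\<Phi>\<close> gives relatedness of \<open>\<P> w\<close> and \<open>\<P> v\<close> along \<open>\<Pi>(\<phi>, \<Phi>)\<close>.
  The equation between interconnections then transports this to \<open>f\<close>, after cancelling the
  isomorphism \<open>T i\<^sub>s\<^sub>t\<close>.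
\<close>

section \<open>Isomorphisms and tensor products\<close>

lemma homI: "\<lbrakk>f \<in> Arr C; Dom C f = a; Cod C f = b\<rbrakk> \<Longrightarrow> f \<in> hom C a b"
  by (simp add: hom_def)

lemma homD:
  assumes "f \<in> hom C a b"
  shows "f \<in> Arr C" "Dom C f = a" "Cod C f = b"
  using assms by (simp_all add: hom_def)

lemma hom_self: "f \<in> Arr C \<Longrightarrow> f \<in> hom C (Dom C f) (Cod C f)"
  by (simp add: hom_def)

context category
begin

declare dom_obj [simp] cod_obj [simp]

lemma ident_simps [simp]:
  assumes "a \<in> Obj C"
  shows "Ident C a \<in> Arr C" "Dom C (Ident C a) = a" "Cod C (Ident C a) = a"
  using homD[OF id_hom[OF assms]] by auto

text \<open>The axioms speak of hom-sets. In terms of \<open>Dom\<close> and \<open>Cod\<close>,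
  typing a composite reduces to equations between objects, which simplification can settle.\<close>

lemma comp_simps [simp]:
  assumes "f \<in> Arr C" "g \<in> Arr C" "Dom C g = Cod C f"
  shows "g \<cdot> f \<in> Arr C" "Dom C (g \<cdot> f) = Dom C f" "Cod C (g \<cdot> f) = Cod C g"
  using homD[OF comp_hom[OF hom_self[OF assms(1)]], of g "Cod C g"] assms
  by (auto simp: hom_def)

lemma ident_comp [simp]:
  assumes "f \<in> Arr C" "Cod C f = b"
  shows "Ident C b \<cdot> f = f"
  using comp_id_left[OF hom_self[OF assms(1)]] assms(2) by simp

lemma comp_ident [simp]:
  assumes "f \<in> Arr C" "Dom C f = a"
  shows "f \<cdot> Ident C a = f"
  using comp_id_right[OF hom_self[OF assms(1)]] assms(2) by simp

lemma assoc_comp: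
  assumes "f \<in> Arr C" "g \<in> Arr C" "h \<in> Arr C" "Dom C g = Cod C f" "Dom C h = Cod C g"
  shows "(h \<cdot> g) \<cdot> f = h \<cdot> (g \<cdot> f)"
  by (rule comp_assoc[OF hom_self[OF assms(1)]]) (use assms in \<open>auto simp: hom_def\<close>)

text \<open>The usual computation
  \<open>g = g \<cdot> (f \<cdot> h) = (g \<cdot> f) \<cdot> h = h\<close>. It makes the definite
  description in \<open>inv_arr\<close> meaningful for isomorphisms.\<close>

lemma inverse_arrows_unique:
  assumes "inverse_arrows C f g" "inverse_arrows C f h"
  shows "g = h"
proof -
  have *: "f \<in> Arr C" "g \<in> Arr C" "h \<in> Arr C" "Dom C g = Cod C f" "Cod C g = Dom C f"
    "Dom C h = Cod C f" "Cod C h = Dom C f"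
    and fh: "f \<cdot> h = Ident C (Cod C f)" and gf: "g \<cdot> f = Ident C (Dom C f)"
    using assms by (auto simp: inverse_arrows_def hom_def)
  have "(g \<cdot> f) \<cdot> h = g \<cdot> (f \<cdot> h)" by (rule assoc_comp) (use * in auto)
  then show ?thesis using * by (simp add: fh gf)
qed

lemma inv_arr_eq: "inverse_arrows C f g \<Longrightarrow> inv_arr C f = g"
  unfolding inv_arr_def by (blast intro: inverse_arrows_unique)

lemma inv_arr_simps [simp]:
  assumes "is_iso C f"
  shows "inv_arr C f \<in> Arr C" "Dom C (inv_arr C f) = Cod C f" "Cod C (inv_arr C f) = Dom C f"
    "inv_arr C f \<cdot> f = Ident C (Dom C f)" "f \<cdot> inv_arr C f = Ident C (Cod C f)"
  using assms inv_arr_eq[of f] unfolding is_iso_def by (auto simp: inverse_arrows_def hom_def)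

lemma iso_arr: "is_iso C f \<Longrightarrow> f \<in> Arr C"
  by (auto simp: is_iso_def inverse_arrows_def)

lemma isoI:
  assumes "f \<in> Arr C" "g \<in> Arr C" "Dom C g = Cod C f" "Cod C g = Dom C f"
    "g \<cdot> f = Ident C (Dom C f)" "f \<cdot> g = Ident C (Cod C f)"
  shows "is_iso C f"
  using assms unfolding is_iso_def inverse_arrows_def by (blast intro: homI)

lemma iso_cancel_left:
  assumes "is_iso C f" "g \<in> Arr C" "h \<in> Arr C" "Cod C g = Dom C f" "Cod C h = Dom C f"
    "f \<cdot> g = f \<cdot> h"
  shows "g = h"
proof -
  have "(inv_arr C f \<cdot> f) \<cdot> g = (inv_arr C f \<cdot> f) \<cdot> h"
    using assms iso_arr[OF assms(1)] by (simp add: assoc_comp del: inv_arr_simps(4))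
  then show ?thesis using assms by simp
qed

lemma ident_iso [simp]: "a \<in> Obj C \<Longrightarrow> is_iso C (Ident C a)"
  by (rule isoI[of _ "Ident C a"]) auto

lemma comp_iso:
  assumes "is_iso C f" "is_iso C g" "Dom C g = Cod C f"
  shows "is_iso C (g \<cdot> f)"
proof (rule isoI[of _ "inv_arr C f \<cdot> inv_arr C g"])
  note [simp] = iso_arr[OF assms(1)] iso_arr[OF assms(2)] assms
  \<comment> \<open>The instance of associativity supplies the cancellation of
    \<open>inv_arr C g\<close> against \<open>g\<close> inside a composite bracketed to the right.
    The second goal cancels \<open>f\<close> against its inverse in the same way.\<close>
  show "inv_arr C f \<cdot> inv_arr C g \<cdot> (g \<cdot> f) = Ident C (Dom C (g \<cdot> f))"
    using assoc_comp[of f g "inv_arr C g"]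
    by (simp add: assoc_comp)
  show "g \<cdot> f \<cdot> (inv_arr C f \<cdot> inv_arr C g) = Ident C (Cod C (g \<cdot> f))"
    using assoc_comp[of "inv_arr C g" "inv_arr C f" f] by (simp add: assoc_comp)
qed (use assms in \<open>simp_all add: iso_arr\<close>)

end

section \<open>Tensor products of arrows, binary and iterated\<close>

context monoidal_category
begin

declare unit_obj_obj [simp] tens_obj_obj [simp]

lemma tens_arr_simps [simp]:
  assumes "f \<in> Arr C" "g \<in> Arr C"
  shows "f \<otimes> g \<in> Arr C" "Dom C (f \<otimes> g) = Dom C f \<otimes>\<^sub>o Dom C g"
    "Cod C (f \<otimes> g) = Cod C f \<otimes>\<^sub>o Cod C g"
  using homD[OF tens_arr_hom[OF hom_self[OF assms(1)] hom_self[OF assms(2)]]] by auto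

lemma runit_simps [simp]:
  assumes "a \<in> Obj C"
  shows "runit C a \<in> Arr C" "Dom C (runit C a) = a \<otimes>\<^sub>o \<one>" "Cod C (runit C a) = a"
  using homD[OF runit_hom[OF assms]] by auto

lemma lunit_simps [simp]:
  assumes "a \<in> Obj C"
  shows "lunit C a \<in> Arr C" "Dom C (lunit C a) = \<one> \<otimes>\<^sub>o a" "Cod C (lunit C a) = a"
  using homD[OF lunit_hom[OF assms]] by auto

lemma interchange:
  assumes "f \<in> Arr C" "g \<in> Arr C" "f' \<in> Arr C" "g' \<in> Arr C" "Dom C g = Cod C f" "Dom C g' = Cod C f'"
  shows "(g \<otimes> g') \<cdot> (f \<otimes> f') = (g \<cdot> f) \<otimes> (g' \<cdot> f')"
  using tens_comp[of f "Dom C f" "Cod C f" g "Cod C g" f' "Dom C f'" "Cod C f'" g' "Cod C g'"] assms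
  by (simp add: hom_def)

lemma tens_iso:
  assumes "is_iso C f" "is_iso C g"
  shows "is_iso C (f \<otimes> g)"
  by (rule isoI[of _ "inv_arr C f \<otimes> inv_arr C g"])
    (use assms iso_arr[OF assms(1)] iso_arr[OF assms(2)] in \<open>simp_all add: interchange tens_id\<close>)

lemma bigtens_obj_obj [simp]: "\<forall>x\<in>set xs. B x \<in> Obj C \<Longrightarrow> bigtens_obj C B xs \<in> Obj C"
  by (induction xs) auto

lemma bigtens_arr_simps:
  assumes "\<forall>x\<in>set xs. f x \<in> Arr C"
  shows "bigtens_arr C f xs \<in> Arr C"
    and "Dom C (bigtens_arr C f xs) = bigtens_obj C (\<lambda>x. Dom C (f x)) xs"
    and "Cod C (bigtens_arr C f xs) = bigtens_obj C (\<lambda>x. Cod C (f x)) xs"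
  using assms by (induction xs) auto

text \<open>Binary interchange, applied once per entry of the list.\<close>

lemma bigtens_arr_comp:
  assumes "\<forall>x\<in>set xs. f x \<in> Arr C \<and> g x \<in> Arr C \<and> Dom C (g x) = Cod C (f x)"
  shows "bigtens_arr C g xs \<cdot> bigtens_arr C f xs = bigtens_arr C (\<lambda>x. g x \<cdot> f x) xs"
  using assms
proof (induction xs)
  case (Cons x xs)
  \<comment> \<open>The two families of objects are known to agree on the list only, so equality of
    their tensor products needs its own induction.\<close>
  have "bigtens_obj C (\<lambda>x. Dom C (g x)) xs = bigtens_obj C (\<lambda>x. Cod C (f x)) xs"
    using Cons.prems by (induction xs) auto
  with Cons show ?case by (simp add: interchange bigtens_arr_simps)
qed simp

end

lemma bigtens_obj_cong:
  "(\<And>x. x \<in> set xs \<Longrightarrow> B x = B' x) \<Longrightarrow> bigtens_obj C B xs = bigtens_obj C B' xs"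
  by (induction xs) auto

text \<open>Families such as the codomains of given arrows match the intended objects on the listed
  indices only. This allows one to be exchanged for the other in a projection.\<close>

lemma bigproj_cong:
  assumes "\<And>x. x \<in> set xs \<Longrightarrow> B x = B' x"
  shows "bigproj C B xs z = bigproj C B' xs z"
  using assms by (induction xs) (auto simp: bigtens_obj_cong[of _ B B'])

lemma bigtens_arr_cong:
  "(\<And>x. x \<in> set xs \<Longrightarrow> f x = g x) \<Longrightarrow> bigtens_arr C f xs = bigtens_arr C g xs"
  by (induction xs) auto


section \<open>Finite products in a cartesian monoidal category\<close>

context cartesian_monoidal_category
begin

lemma discard_simps [simp]:
  assumes "a \<in> Obj C"
  shows "discard C a \<in> Arr C" "Dom C (discard C a) = a" "Cod C (discard C a) = \<one>"
proof -
  have "\<exists>!f. f \<in> hom C a \<one>" using unit_terminal assms by (auto simp: is_terminal_def)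
  from theI'[OF this] have "discard C a \<in> hom C a \<one>" unfolding discard_def .
  then show "discard C a \<in> Arr C" "Dom C (discard C a) = a" "Cod C (discard C a) = \<one>"
    by (auto simp: hom_def)
qed

lemma terminal_eq:
  assumes "f \<in> Arr C" "g \<in> Arr C" "Cod C f = \<one>" "Cod C g = \<one>" "Dom C f = Dom C g"
  shows "f = g"
proof -
  have "\<exists>!h. h \<in> hom C (Dom C f) \<one>"
    using unit_terminal dom_obj[OF assms(1)] by (auto simp: is_terminal_def)
  moreover have "f \<in> hom C (Dom C f) \<one>" "g \<in> hom C (Dom C f) \<one>" using assms by (auto simp: hom_def)
  ultimately show ?thesis by blast
qed

lemma proj_simps [simp]:
  assumes "a \<in> Obj C" "b \<in> Obj C"
  shows "proj\<^sub>1 C a b \<in> Arr C" "Dom C (proj\<^sub>1 C a b) = a \<otimes>\<^sub>o b" "Cod C (proj\<^sub>1 C a b) = a"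
    "proj\<^sub>2 C a b \<in> Arr C" "Dom C (proj\<^sub>2 C a b) = a \<otimes>\<^sub>o b" "Cod C (proj\<^sub>2 C a b) = b"
  using assms by (simp_all add: proj\<^sub>1_def proj\<^sub>2_def)

text \<open>Terminality of the unit lets \<open>discard\<close> absorb \<open>g\<close>; naturality
  of \<open>runit\<close> then carries \<open>f\<close> across.\<close>

lemma proj1_nat:
  assumes "f \<in> Arr C" "g \<in> Arr C"
  shows "proj\<^sub>1 C (Cod C f) (Cod C g) \<cdot> (f \<otimes> g) = f \<cdot> proj\<^sub>1 C (Dom C f) (Dom C g)"
proof -
  have "discard C (Cod C g) \<cdot> g = discard C (Dom C g)" using assms by (intro terminal_eq) auto
  \<comment> \<open>The tensor is split because naturality of \<open>runit\<close> only concerns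
    \<open>f\<close> tensored with the identity of the unit.\<close>
  moreover have "runit C (Cod C f) \<cdot> (f \<otimes> discard C (Dom C g))
      = runit C (Cod C f) \<cdot> ((f \<otimes> Ident C \<one>) \<cdot> (Ident C (Dom C f) \<otimes> discard C (Dom C g)))"
    using assms by (simp add: interchange)
  moreover have "\<dots> = f \<cdot> runit C (Dom C f) \<cdot> (Ident C (Dom C f) \<otimes> discard C (Dom C g))"
    using assms by (simp add: runit_nat[OF hom_self, symmetric] assoc_comp)
  ultimately show ?thesis using assms by (simp add: proj\<^sub>1_def interchange assoc_comp)
qed

lemma proj2_nat:
  assumes "f \<in> Arr C" "g \<in> Arr C"
  shows "proj\<^sub>2 C (Cod C f) (Cod C g) \<cdot> (f \<otimes> g) = g \<cdot> proj\<^sub>2 C (Dom C f) (Dom C g)"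
proof -
  have "discard C (Cod C f) \<cdot> f = discard C (Dom C f)" using assms by (intro terminal_eq) auto
  moreover have "lunit C (Cod C g) \<cdot> (discard C (Dom C f) \<otimes> g)
      = lunit C (Cod C g) \<cdot> ((Ident C \<one> \<otimes> g) \<cdot> (discard C (Dom C f) \<otimes> Ident C (Dom C g)))"
    using assms by (simp add: interchange)
  moreover have "\<dots> = g \<cdot> lunit C (Dom C g) \<cdot> (discard C (Dom C f) \<otimes> Ident C (Dom C g))"
    using assms by (simp add: lunit_nat[OF hom_self, symmetric] assoc_comp)
  ultimately show ?thesis using assms by (simp add: proj\<^sub>2_def interchange assoc_comp)
qed

lemma bigproj_simps:
  assumes "\<forall>x\<in>set xs. B x \<in> Obj C" "z \<in> set xs"
  shows "bigproj C B xs z \<in> Arr C" "Dom C (bigproj C B xs z) = bigtens_obj C B xs"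
    "Cod C (bigproj C B xs z) = B z"
  using assms by (induction xs) auto

text \<open>At the head this is \<open>proj1_nat\<close>. For a later index \<open>proj2_nat\<close>
  drops the head factor and the induction hypothesis treats the tail.\<close>

lemma bigproj_nat:
  assumes "\<forall>x\<in>set xs. f x \<in> Arr C" "z \<in> set xs"
  shows "bigproj C (\<lambda>x. Cod C (f x)) xs z \<cdot> bigtens_arr C f xs
    = f z \<cdot> bigproj C (\<lambda>x. Dom C (f x)) xs z"
  using assms
proof (induction xs)
  case (Cons x xs)
  note b = bigtens_arr_simps[of xs f]
  show ?case
  proof (cases "z = x")
    case True
    then show ?thesis using Cons.prems proj1_nat[of "f x" "bigtens_arr C f xs"] b by simp
  next
    case False
    with Cons have z: "z \<in> set xs" by simp
    let ?p = "bigproj C (\<lambda>x. Cod C (f x)) xs z" and ?q = "bigproj C (\<lambda>x. Dom C (f x)) xs z"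
    note p = bigproj_simps[of xs "\<lambda>x. Cod C (f x)" z] bigproj_simps[of xs "\<lambda>x. Dom C (f x)" z]
    have "?p \<cdot> proj\<^sub>2 C (Cod C (f x)) (bigtens_obj C (\<lambda>x. Cod C (f x)) xs) \<cdot> (f x \<otimes> bigtens_arr C f xs)
      = ?p \<cdot> (bigtens_arr C f xs \<cdot> proj\<^sub>2 C (Dom C (f x)) (bigtens_obj C (\<lambda>x. Dom C (f x)) xs))"
      using Cons.prems z b p proj2_nat[of "f x" "bigtens_arr C f xs"] by (simp add: assoc_comp)
    also have "\<dots> = f z \<cdot> ?q \<cdot> proj\<^sub>2 C (Dom C (f x)) (bigtens_obj C (\<lambda>x. Dom C (f x)) xs)"
      using Cons z b p by (simp add: assoc_comp[symmetric])
    also have "\<dots> = f z \<cdot> (?q \<cdot> proj\<^sub>2 C (Dom C (f x)) (bigtens_obj C (\<lambda>x. Dom C (f x)) xs))"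
      using Cons.prems z b p by (simp add: assoc_comp)
    finally show ?thesis using False by simp
  qed
qed simp

text \<open>Uniqueness in binary products, iterated, with terminality of the unit for the empty
  list. \<open>bigproj\<close> stops at the first occurrence of an index, so a repeated index would
  leave a later factor untested; hence \<open>distinct\<close>.\<close>

lemma bigproj_eqI:
  assumes "distinct xs" "\<forall>x\<in>set xs. B x \<in> Obj C"
    and "h \<in> hom C c (bigtens_obj C B xs)" "k \<in> hom C c (bigtens_obj C B xs)"
    and "\<And>x. x \<in> set xs \<Longrightarrow> bigproj C B xs x \<cdot> h = bigproj C B xs x \<cdot> k"
  shows "h = k"
  using assms
proof (induction xs arbitrary: h k)
  case Nil
  then show ?case by (intro terminal_eq) (auto simp: hom_def)
next
  case (Cons x xs)
  let ?P = "bigtens_obj C B xs"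
  have obj: "B x \<in> Obj C" "?P \<in> Obj C" "\<forall>x\<in>set xs. B x \<in> Obj C" using Cons.prems by auto
  note hk = homD[OF Cons.prems(3)] homD[OF Cons.prems(4)]
  have 1: "proj\<^sub>1 C (B x) ?P \<cdot> h = proj\<^sub>1 C (B x) ?P \<cdot> k"
    using Cons.prems(5)[of x] by simp
  have 2: "proj\<^sub>2 C (B x) ?P \<cdot> h = proj\<^sub>2 C (B x) ?P \<cdot> k"
  proof (rule Cons.IH)
    show "distinct xs" "\<forall>x\<in>set xs. B x \<in> Obj C" using Cons.prems by auto
    show "proj\<^sub>2 C (B x) ?P \<cdot> h \<in> hom C c ?P" "proj\<^sub>2 C (B x) ?P \<cdot> k \<in> hom C c ?P"
      using hk obj by (auto intro!: homI)
    fix y assume y: "y \<in> set xs"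
    \<comment> \<open>Distinctness gives \<open>y \<noteq> x\<close>, so \<open>bigproj\<close> at
      \<open>y\<close> takes its second branch and factors through
      \<open>proj\<^sub>2\<close>.\<close>
    with Cons.prems(1) Cons.prems(5)[of y] have "bigproj C B xs y \<cdot> proj\<^sub>2 C (B x) ?P \<cdot> h
        = bigproj C B xs y \<cdot> proj\<^sub>2 C (B x) ?P \<cdot> k" by (auto split: if_splits)
    then show "bigproj C B xs y \<cdot> (proj\<^sub>2 C (B x) ?P \<cdot> h) = bigproj C B xs y \<cdot> (proj\<^sub>2 C (B x) ?P \<cdot> k)"
      using hk obj y bigproj_simps[OF obj(3) y] by (simp add: assoc_comp)
  qed
  have c: "c \<in> Obj C" using dom_obj[OF hk(1)] hk(2) by simp
  have "\<exists>!l. l \<in> hom C c (B x \<otimes>\<^sub>o ?P) \<and> proj\<^sub>1 C (B x) ?P \<cdot> l = proj\<^sub>1 C (B x) ?P \<cdot> h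
      \<and> proj\<^sub>2 C (B x) ?P \<cdot> l = proj\<^sub>2 C (B x) ?P \<cdot> h"
    using tens_product[OF obj(1,2)] c hk obj unfolding is_product_def by (auto simp: hom_def)
  then show ?case using 1 2 Cons.prems(3,4) by auto
qed

text \<open>The existence half of the universal property: the arrow for the head is paired with the
  arrow already built for the tail.\<close>

lemma bigproj_lift:
  assumes "distinct xs" "\<forall>x\<in>set xs. f x \<in> hom C c (B x)" "\<forall>x\<in>set xs. B x \<in> Obj C" "c \<in> Obj C"
  shows "\<exists>h \<in> hom C c (bigtens_obj C B xs). \<forall>x\<in>set xs. bigproj C B xs x \<cdot> h = f x"
  using assms
proof (induction xs)
  case Nil
  \<comment> \<open>The empty product is the terminal unit, so \<open>discard\<close> is the
    mediating arrow.\<close>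
  then show ?case by (intro bexI[of _ "discard C c"]) (auto intro!: homI)
next
  case (Cons x xs)
  let ?P = "bigtens_obj C B xs"
  have obj: "B x \<in> Obj C" "?P \<in> Obj C" "\<forall>x\<in>set xs. B x \<in> Obj C" using Cons.prems by auto
  from Cons obtain k where k: "k \<in> hom C c ?P" "\<forall>x\<in>set xs. bigproj C B xs x \<cdot> k = f x" by auto
  obtain h where h: "h \<in> hom C c (B x \<otimes>\<^sub>o ?P)" "proj\<^sub>1 C (B x) ?P \<cdot> h = f x"
      "proj\<^sub>2 C (B x) ?P \<cdot> h = k"
    using tens_product[OF obj(1,2)] Cons.prems(2,4) k(1) unfolding is_product_def
    by (metis list.set_intros(1))
  have "bigproj C B (x # xs) y \<cdot> h = f y" if "y \<in> set (x # xs)" for y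
  proof (cases "y = x")
    case False
    with that have y: "y \<in> set xs" by simp
    then show ?thesis using False h k(2) bigproj_simps[OF obj(3) y] homD[OF h(1)] obj
      by (simp add: assoc_comp)
  qed (use h in simp)
  with h(1) show ?case unfolding bigtens_obj.simps by blast
qed

end


section \<open>Iterated structure maps of a strong monoidal functor\<close>

context cat_functor
begin

lemma farr_simps [simp]:
  assumes "f \<in> Arr C"
  shows "farr F f \<in> Arr D" "Dom D (farr F f) = fobj F (Dom C f)" "Cod D (farr F f) = fobj F (Cod C f)"
  using homD[OF farr_hom[OF hom_self[OF assms]]] by auto

declare fobj_obj [simp]

lemma farr_comp':
  assumes "f \<in> Arr C" "g \<in> Arr C" "Dom C g = Cod C f"
  shows "farr F (g \<cdot>\<^bsub>C\<^esub> f) = farr F g \<cdot>\<^bsub>D\<^esub> farr F f"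
  by (rule farr_comp[OF hom_self]) (use assms in \<open>auto simp: hom_def\<close>)

lemma farr_iso:
  assumes "is_iso C f"
  shows "is_iso D (farr F f)"
  by (rule D.isoI[of _ "farr F (inv_arr C f)"])
    (use assms C.iso_arr[OF assms] in \<open>simp_all add: farr_comp'[symmetric] farr_id\<close>)

end

context strong_monoidal_functor
begin

lemma fmult_simps [simp]:
  assumes "a \<in> Obj C" "b \<in> Obj C"
  shows "fmult F a b \<in> Arr D" "Dom D (fmult F a b) = fobj F a \<otimes>\<^sub>o\<^bsub>D\<^esub> fobj F b"
    "Cod D (fmult F a b) = fobj F (a \<otimes>\<^sub>o\<^bsub>C\<^esub> b)"
  using homD[OF fmult_hom[OF assms]] by auto

lemma funit_simps [simp]:
  shows "funit F \<in> Arr D" "Dom D (funit F) = \<one>\<^bsub>D\<^esub>" "Cod D (funit F) = fobj F \<one>\<^bsub>C\<^esub>"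
  using homD[OF funit_hom] by auto

lemma bigmult_simps:
  assumes "\<forall>x\<in>set xs. B x \<in> Obj C"
  shows "bigmult C D F B xs \<in> Arr D"
    and "Dom D (bigmult C D F B xs) = bigtens_obj D (\<lambda>x. fobj F (B x)) xs"
    and "Cod D (bigmult C D F B xs) = fobj F (bigtens_obj C B xs)"
  using assms by (induction xs) auto

lemma bigmult_iso:
  assumes "\<forall>x\<in>set xs. B x \<in> Obj C"
  shows "is_iso D (bigmult C D F B xs)"
  using assms
  by (induction xs)
    (auto intro!: D.comp_iso D.tens_iso fmult_iso funit_iso simp: bigmult_simps)

text \<open>Interchange exposes the tail, the induction hypothesis moves its comparison map across,
  and \<open>fmult_nat\<close> does the same for the outer one.\<close>

lemma bigmult_nat:
  assumes "\<forall>x\<in>set xs. f x \<in> Arr C"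
  shows "bigmult C D F (\<lambda>x. Cod C (f x)) xs \<cdot>\<^bsub>D\<^esub> bigtens_arr D (\<lambda>x. farr F (f x)) xs
    = farr F (bigtens_arr C f xs) \<cdot>\<^bsub>D\<^esub> bigmult C D F (\<lambda>x. Dom C (f x)) xs"
  using assms
proof (induction xs)
  case Nil
  then show ?case by (simp add: farr_id)
next
  case (Cons x xs)
  let ?m = "bigmult C D F (\<lambda>x. Cod C (f x)) xs" and ?n = "bigmult C D F (\<lambda>x. Dom C (f x)) xs"
  let ?t = "bigtens_arr D (\<lambda>x. farr F (f x)) xs" and ?s = "bigtens_arr C f xs"
  have a: "f x \<in> Arr C" "\<forall>x\<in>set xs. f x \<in> Arr C" using Cons.prems by auto
  have b: "\<forall>x\<in>set xs. farr F (f x) \<in> Arr D" "\<forall>x\<in>set xs. Cod C (f x) \<in> Obj C"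
    "\<forall>x\<in>set xs. Dom C (f x) \<in> Obj C" using a by auto
  \<comment> \<open>These equations hold entrywise on the list only, so congruence must be invoked
    before simplification can match the objects.\<close>
  have e: "bigtens_obj D (\<lambda>x. Cod D (farr F (f x))) xs = bigtens_obj D (\<lambda>x. fobj F (Cod C (f x))) xs"
    "bigtens_obj D (\<lambda>x. Dom D (farr F (f x))) xs = bigtens_obj D (\<lambda>x. fobj F (Dom C (f x))) xs"
    using a by (auto intro!: bigtens_obj_cong)
  note [simp] = a b e bigmult_simps[OF b(2)] bigmult_simps[OF b(3)]
    D.bigtens_arr_simps[OF b(1)] C.bigtens_arr_simps[OF a(2)]
  have "fmult F (Cod C (f x)) (Cod C ?s) \<cdot>\<^bsub>D\<^esub> (Ident D (fobj F (Cod C (f x))) \<otimes>\<^bsub>D\<^esub> ?m)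
      \<cdot>\<^bsub>D\<^esub> (farr F (f x) \<otimes>\<^bsub>D\<^esub> ?t)
    = fmult F (Cod C (f x)) (Cod C ?s) \<cdot>\<^bsub>D\<^esub> (farr F (f x) \<otimes>\<^bsub>D\<^esub> (farr F ?s \<cdot>\<^bsub>D\<^esub> ?n))"
    using Cons by (simp add: D.assoc_comp D.interchange)
  also have "\<dots> = fmult F (Cod C (f x)) (Cod C ?s) \<cdot>\<^bsub>D\<^esub> (farr F (f x) \<otimes>\<^bsub>D\<^esub> farr F ?s)
      \<cdot>\<^bsub>D\<^esub> (Ident D (fobj F (Dom C (f x))) \<otimes>\<^bsub>D\<^esub> ?n)"
    by (simp add: D.assoc_comp D.interchange)
  also have "\<dots> = farr F (f x \<otimes>\<^bsub>C\<^esub> ?s) \<cdot>\<^bsub>D\<^esub> (fmult F (Dom C (f x)) (Dom C ?s)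
      \<cdot>\<^bsub>D\<^esub> (Ident D (fobj F (Dom C (f x))) \<otimes>\<^bsub>D\<^esub> ?n))"
    using fmult_nat[OF hom_self[OF a(1)] hom_self[of ?s C]] by (simp add: D.assoc_comp)
  finally show ?case by simp
qed

end

text \<open>No compatibility with projections is assumed: it follows from terminality of both units
  and the coherence axioms of a strong monoidal functor.\<close>

locale cartesian_monoidal_functor =
  C: cartesian_monoidal_category C + D: cartesian_monoidal_category D + strong_monoidal_functor C D F
  for C :: "('o, 'm, 'y) moncat_scheme" and D :: "('p, 'n, 'z) moncat_scheme"
    and F :: "('o, 'm, 'p, 'n, 'w) monfun_scheme"
begin

text \<open>After composing with the inverse of \<open>funit F\<close>, both sides are arrows into
  the terminal unit of \<open>D\<close> and hence equal. This is where invertibility of the unit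
  comparison enters.\<close>

lemma farr_discard:
  assumes "b \<in> Obj C"
  shows "farr F (discard C b) = funit F \<cdot>\<^bsub>D\<^esub> discard D (fobj F b)"
proof -
  have [simp]: "is_iso D (funit F)" by (rule funit_iso)
  have "inv_arr D (funit F) \<cdot>\<^bsub>D\<^esub> farr F (discard C b) = discard D (fobj F b)"
    using assms by (intro D.terminal_eq) auto
  then have "funit F \<cdot>\<^bsub>D\<^esub> inv_arr D (funit F) \<cdot>\<^bsub>D\<^esub> farr F (discard C b)
      = funit F \<cdot>\<^bsub>D\<^esub> discard D (fobj F b)"
    using assms by (simp add: D.assoc_comp del: D.inv_arr_simps(5))
  then show ?thesis using assms by simp
qed

text \<open>\<open>fmult_nat\<close> pulls \<open>F\<close> inside the tensor,
  \<open>farr_discard\<close> turns the discarded factor into \<open>funit F\<close> after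
  \<open>discard\<close>, and \<open>fmult_runit\<close> converts the remaining unitor of
  \<open>C\<close> into that of \<open>D\<close>.\<close>

lemma farr_proj1:
  assumes "a \<in> Obj C" "b \<in> Obj C"
  shows "farr F (proj\<^sub>1 C a b) \<cdot>\<^bsub>D\<^esub> fmult F a b = proj\<^sub>1 D (fobj F a) (fobj F b)"
proof -
  have "farr F (proj\<^sub>1 C a b) \<cdot>\<^bsub>D\<^esub> fmult F a b
    = farr F (runit C a) \<cdot>\<^bsub>D\<^esub> (farr F (Ident C a \<otimes>\<^bsub>C\<^esub> discard C b) \<cdot>\<^bsub>D\<^esub> fmult F a b)"
    using assms by (simp add: proj\<^sub>1_def farr_comp' D.assoc_comp)
  also have "farr F (Ident C a \<otimes>\<^bsub>C\<^esub> discard C b) \<cdot>\<^bsub>D\<^esub> fmult F a b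
    = fmult F a \<one>\<^bsub>C\<^esub> \<cdot>\<^bsub>D\<^esub> (Ident D (fobj F a) \<otimes>\<^bsub>D\<^esub> (funit F \<cdot>\<^bsub>D\<^esub> discard D (fobj F b)))"
    using fmult_nat[OF hom_self[of "Ident C a"] hom_self[of "discard C b"]] assms
    by (simp add: farr_id farr_discard)
  also have "\<dots> = fmult F a \<one>\<^bsub>C\<^esub> \<cdot>\<^bsub>D\<^esub> ((Ident D (fobj F a) \<otimes>\<^bsub>D\<^esub> funit F)
      \<cdot>\<^bsub>D\<^esub> (Ident D (fobj F a) \<otimes>\<^bsub>D\<^esub> discard D (fobj F b)))"
    using assms by (simp add: D.interchange)
  also have "farr F (runit C a) \<cdot>\<^bsub>D\<^esub> \<dots> = (farr F (runit C a) \<cdot>\<^bsub>D\<^esub> fmult F a \<one>\<^bsub>C\<^esub>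
      \<cdot>\<^bsub>D\<^esub> (Ident D (fobj F a) \<otimes>\<^bsub>D\<^esub> funit F)) \<cdot>\<^bsub>D\<^esub> (Ident D (fobj F a) \<otimes>\<^bsub>D\<^esub> discard D (fobj F b))"
    using assms by (simp add: D.assoc_comp)
  finally show ?thesis using assms by (simp only: fmult_runit proj\<^sub>1_def)
qed

lemma farr_proj2:
  assumes "a \<in> Obj C" "b \<in> Obj C"
  shows "farr F (proj\<^sub>2 C a b) \<cdot>\<^bsub>D\<^esub> fmult F a b = proj\<^sub>2 D (fobj F a) (fobj F b)"
proof -
  have "farr F (proj\<^sub>2 C a b) \<cdot>\<^bsub>D\<^esub> fmult F a b
    = farr F (lunit C b) \<cdot>\<^bsub>D\<^esub> (farr F (discard C a \<otimes>\<^bsub>C\<^esub> Ident C b) \<cdot>\<^bsub>D\<^esub> fmult F a b)"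
    using assms by (simp add: proj\<^sub>2_def farr_comp' D.assoc_comp)
  also have "farr F (discard C a \<otimes>\<^bsub>C\<^esub> Ident C b) \<cdot>\<^bsub>D\<^esub> fmult F a b
    = fmult F \<one>\<^bsub>C\<^esub> b \<cdot>\<^bsub>D\<^esub> ((funit F \<cdot>\<^bsub>D\<^esub> discard D (fobj F a)) \<otimes>\<^bsub>D\<^esub> Ident D (fobj F b))"
    using fmult_nat[OF hom_self[of "discard C a"] hom_self[of "Ident C b"]] assms
    by (simp add: farr_id farr_discard)
  also have "\<dots> = fmult F \<one>\<^bsub>C\<^esub> b \<cdot>\<^bsub>D\<^esub> ((funit F \<otimes>\<^bsub>D\<^esub> Ident D (fobj F b))
      \<cdot>\<^bsub>D\<^esub> (discard D (fobj F a) \<otimes>\<^bsub>D\<^esub> Ident D (fobj F b)))"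
    using assms by (simp add: D.interchange)
  also have "farr F (lunit C b) \<cdot>\<^bsub>D\<^esub> \<dots> = (farr F (lunit C b) \<cdot>\<^bsub>D\<^esub> fmult F \<one>\<^bsub>C\<^esub> b
      \<cdot>\<^bsub>D\<^esub> (funit F \<otimes>\<^bsub>D\<^esub> Ident D (fobj F b))) \<cdot>\<^bsub>D\<^esub> (discard D (fobj F a) \<otimes>\<^bsub>D\<^esub> Ident D (fobj F b))"
    using assms by (simp add: D.assoc_comp)
  finally show ?thesis using assms by (simp only: fmult_lunit proj\<^sub>2_def)
qed

text \<open>\<open>farr_proj1\<close> and \<open>farr_proj2\<close> handle the outer comparison map;
  naturality of the projections in \<open>D\<close> then removes the comparison of the tail or
  brings it in front for the induction hypothesis.\<close>

lemma farr_bigproj: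
  assumes "\<forall>x\<in>set xs. B x \<in> Obj C" "z \<in> set xs"
  shows "farr F (bigproj C B xs z) \<cdot>\<^bsub>D\<^esub> bigmult C D F B xs = bigproj D (\<lambda>x. fobj F (B x)) xs z"
  using assms
proof (induction xs)
  case (Cons x xs)
  let ?P = "bigtens_obj C B xs" and ?Q = "bigtens_obj D (\<lambda>x. fobj F (B x)) xs"
  let ?m = "bigmult C D F B xs" and ?i = "Ident D (fobj F (B x))"
  have obj: "B x \<in> Obj C" "?P \<in> Obj C" "?Q \<in> Obj D" "\<forall>x\<in>set xs. B x \<in> Obj C"
    using Cons.prems by auto
  note [simp] = obj bigmult_simps[OF obj(4)]
  show ?case
  proof (cases "z = x")
    case True
    have "farr F (proj\<^sub>1 C (B x) ?P) \<cdot>\<^bsub>D\<^esub> (fmult F (B x) ?P \<cdot>\<^bsub>D\<^esub> (?i \<otimes>\<^bsub>D\<^esub> ?m))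
      = proj\<^sub>1 D (fobj F (B x)) (fobj F ?P) \<cdot>\<^bsub>D\<^esub> (?i \<otimes>\<^bsub>D\<^esub> ?m)"
      by (simp add: D.assoc_comp[symmetric] farr_proj1)
    also have "\<dots> = proj\<^sub>1 D (fobj F (B x)) ?Q"
      using D.proj1_nat[of ?i ?m] by simp
    finally show ?thesis using True by simp
  next
    case False
    with Cons.prems have z: "z \<in> set xs" by simp
    note [simp] = C.bigproj_simps[OF obj(4) z]
    have "farr F (bigproj C B xs z \<cdot>\<^bsub>C\<^esub> proj\<^sub>2 C (B x) ?P) \<cdot>\<^bsub>D\<^esub> (fmult F (B x) ?P \<cdot>\<^bsub>D\<^esub> (?i \<otimes>\<^bsub>D\<^esub> ?m))
      = farr F (bigproj C B xs z) \<cdot>\<^bsub>D\<^esub> (farr F (proj\<^sub>2 C (B x) ?P) \<cdot>\<^bsub>D\<^esub> fmult F (B x) ?P \<cdot>\<^bsub>D\<^esub> (?i \<otimes>\<^bsub>D\<^esub> ?m))"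
      by (simp add: D.assoc_comp farr_comp')
    also have "\<dots> = farr F (bigproj C B xs z) \<cdot>\<^bsub>D\<^esub> (?m \<cdot>\<^bsub>D\<^esub> proj\<^sub>2 D (fobj F (B x)) ?Q)"
      using D.proj2_nat[of ?i ?m] by (simp add: farr_proj2)
    also have "\<dots> = farr F (bigproj C B xs z) \<cdot>\<^bsub>D\<^esub> ?m \<cdot>\<^bsub>D\<^esub> proj\<^sub>2 D (fobj F (B x)) ?Q"
      by (simp add: D.assoc_comp)
    finally show ?thesis using False Cons.IH[OF obj(4) z] by simp
  qed
qed simp

end

context monoidal_nat_trans
begin

lemma component_simps [simp]:
  assumes "c \<in> Obj C"
  shows "\<tau> c \<in> Arr D" "Dom D (\<tau> c) = fobj T c" "Cod D (\<tau> c) = fobj U c"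
  using homD[OF comp_hom[OF assms]] by auto

text \<open>The empty list is \<open>unit_compat\<close>. Each further entry is split off by
  \<open>mult_compat\<close>, and interchange hands the tail to the induction hypothesis.\<close>

lemma bigmult_compat:
  assumes "\<forall>x\<in>set xs. B x \<in> Obj C"
  shows "\<tau> (bigtens_obj C B xs) \<cdot>\<^bsub>D\<^esub> bigmult C D T B xs
    = bigmult C D U B xs \<cdot>\<^bsub>D\<^esub> bigtens_arr D (\<lambda>x. \<tau> (B x)) xs"
  using assms
proof (induction xs)
  case Nil
  then show ?case by (simp add: unit_compat)
next
  case (Cons x xs)
  let ?P = "bigtens_obj C B xs" and ?t = "bigtens_arr D (\<lambda>x. \<tau> (B x)) xs"
  let ?m = "bigmult C D T B xs" and ?n = "bigmult C D U B xs"
  have obj: "B x \<in> Obj C" "?P \<in> Obj C" "\<forall>x\<in>set xs. B x \<in> Obj C" using Cons.prems by auto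
  have a: "\<forall>x\<in>set xs. \<tau> (B x) \<in> Arr D" using obj by auto
  have e: "bigtens_obj D (\<lambda>x. Cod D (\<tau> (B x))) xs = bigtens_obj D (\<lambda>x. fobj U (B x)) xs"
    "bigtens_obj D (\<lambda>x. Dom D (\<tau> (B x))) xs = bigtens_obj D (\<lambda>x. fobj T (B x)) xs"
    using obj by (auto intro!: bigtens_obj_cong)
  note [simp] = obj T.bigmult_simps[OF obj(3)] U.bigmult_simps[OF obj(3)]
    T.D.bigtens_arr_simps[OF a] e
  have "\<tau> (B x \<otimes>\<^sub>o\<^bsub>C\<^esub> ?P) \<cdot>\<^bsub>D\<^esub> (fmult T (B x) ?P \<cdot>\<^bsub>D\<^esub> (Ident D (fobj T (B x)) \<otimes>\<^bsub>D\<^esub> ?m))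
    = fmult U (B x) ?P \<cdot>\<^bsub>D\<^esub> (\<tau> (B x) \<otimes>\<^bsub>D\<^esub> \<tau> ?P) \<cdot>\<^bsub>D\<^esub> (Ident D (fobj T (B x)) \<otimes>\<^bsub>D\<^esub> ?m)"
    by (simp add: T.D.assoc_comp[symmetric] mult_compat)
  also have "\<dots> = fmult U (B x) ?P \<cdot>\<^bsub>D\<^esub> (Ident D (fobj U (B x)) \<otimes>\<^bsub>D\<^esub> ?n) \<cdot>\<^bsub>D\<^esub> (\<tau> (B x) \<otimes>\<^bsub>D\<^esub> ?t)"
    using Cons.IH by (simp add: T.D.assoc_comp T.D.interchange)
  finally show ?case by simp
qed

end


section \<open>The total and state functors of a subcategory of arrows\<close>

text \<open>The composite of \<open>F\<close> with the domain functor from \<open>A\<close> to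
  \<open>C\<close>. The latter is strict monoidal, so the comparison maps are those of
  \<open>F\<close> at the domains. \<open>st_fun\<close> is the analogue for codomains.\<close>

definition tot_fun :: "('o, 'm) moncat \<Rightarrow> ('o, 'm, 'p, 'n) monfun \<Rightarrow> ('m, 'm square, 'p, 'n) monfun" where
  "tot_fun C F = \<lparr> fobj = (\<lambda>p. fobj F (Dom C p)), farr = (\<lambda>s. farr F (tot s)),
    fmult = (\<lambda>p q. fmult F (Dom C p) (Dom C q)), funit = funit F \<rparr>"

definition st_fun :: "('o, 'm) moncat \<Rightarrow> ('o, 'm, 'p, 'n) monfun \<Rightarrow> ('m, 'm square, 'p, 'n) monfun" where
  "st_fun C F = \<lparr> fobj = (\<lambda>p. fobj F (Cod C p)), farr = (\<lambda>s. farr F (st s)),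
    fmult = (\<lambda>p q. fmult F (Cod C p) (Cod C q)), funit = funit F \<rparr>"

text \<open>Closure of \<open>A\<close> under the structure is carried by its being a monoidal
  category with the operations of the arrow category, as in
  \<open>cartesian_monoidal_subcategory\<close>.\<close>

locale arrow_subcategory =
  C: monoidal_category C + A: monoidal_category A
  for C :: "('o, 'm) moncat" and A :: "('m, 'm square) moncat" +
  assumes A_eq: "A = arrow_cat C\<lparr>Obj := Obj A, Arr := Arr A\<rparr>"
    and Obj_sub: "Obj A \<subseteq> Obj (arrow_cat C)"
    and Arr_sub: "Arr A \<subseteq> Arr (arrow_cat C)"
begin

lemma operations:
  shows "Dom A = sq_dom" "Cod A = sq_cod"
    and "Ident A p = Square p (Ident C (Dom C p)) (Ident C (Cod C p)) p"
    and "s \<cdot>\<^bsub>A\<^esub> t = Square (sq_dom t) (tot s \<cdot>\<^bsub>C\<^esub> tot t) (st s \<cdot>\<^bsub>C\<^esub> st t) (sq_cod s)"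
    and "s \<otimes>\<^bsub>A\<^esub> t = Square (sq_dom s \<otimes>\<^bsub>C\<^esub> sq_dom t) (tot s \<otimes>\<^bsub>C\<^esub> tot t)
      (st s \<otimes>\<^bsub>C\<^esub> st t) (sq_cod s \<otimes>\<^bsub>C\<^esub> sq_cod t)"
    and "assoc A p q r = Square ((p \<otimes>\<^bsub>C\<^esub> q) \<otimes>\<^bsub>C\<^esub> r) (assoc C (Dom C p) (Dom C q) (Dom C r))
      (assoc C (Cod C p) (Cod C q) (Cod C r)) (p \<otimes>\<^bsub>C\<^esub> (q \<otimes>\<^bsub>C\<^esub> r))"
    and "lunit A p = Square (Ident C \<one>\<^bsub>C\<^esub> \<otimes>\<^bsub>C\<^esub> p) (lunit C (Dom C p)) (lunit C (Cod C p)) p"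
    and "runit A p = Square (p \<otimes>\<^bsub>C\<^esub> Ident C \<one>\<^bsub>C\<^esub>) (runit C (Dom C p)) (runit C (Cod C p)) p"
  \<comment> \<open>\<open>A\<close> occurs on both sides of \<open>A_eq\<close>, so the equation is
    substituted once instead of serving as a rewrite rule.\<close>
  by (subst A_eq, simp add: arrow_cat_def)+

lemma tens_obj_A [simp]: "p \<otimes>\<^sub>o\<^bsub>A\<^esub> q = p \<otimes>\<^bsub>C\<^esub> q" and unit_obj_A [simp]: "\<one>\<^bsub>A\<^esub> = Ident C \<one>\<^bsub>C\<^esub>"
  by (subst A_eq, simp add: arrow_cat_def)+

lemma obj_arr [simp]: "p \<in> Obj A \<Longrightarrow> p \<in> Arr C"
  using Obj_sub by (auto simp: arrow_cat_def)

lemma square_simps [simp]: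
  assumes "s \<in> Arr A"
  shows "tot s \<in> Arr C" "Dom C (tot s) = Dom C (Dom A s)" "Cod C (tot s) = Dom C (Cod A s)"
    and "st s \<in> Arr C" "Dom C (st s) = Cod C (Dom A s)" "Cod C (st s) = Cod C (Cod A s)"
  using assms Arr_sub by (auto simp: arrow_cat_def hom_def operations)

lemma square_commutes: "s \<in> Arr A \<Longrightarrow> Cod A s \<cdot>\<^bsub>C\<^esub> tot s = st s \<cdot>\<^bsub>C\<^esub> Dom A s"
  using Arr_sub by (auto simp: arrow_cat_def operations)

lemma component_simps [simp]:
  shows "tot (Ident A p) = Ident C (Dom C p)" "st (Ident A p) = Ident C (Cod C p)"
    and "tot (s \<cdot>\<^bsub>A\<^esub> t) = tot s \<cdot>\<^bsub>C\<^esub> tot t" "st (s \<cdot>\<^bsub>A\<^esub> t) = st s \<cdot>\<^bsub>C\<^esub> st t"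
    and "tot (s \<otimes>\<^bsub>A\<^esub> t) = tot s \<otimes>\<^bsub>C\<^esub> tot t" "st (s \<otimes>\<^bsub>A\<^esub> t) = st s \<otimes>\<^bsub>C\<^esub> st t"
    and "tot (assoc A p q r) = assoc C (Dom C p) (Dom C q) (Dom C r)"
    and "st (assoc A p q r) = assoc C (Cod C p) (Cod C q) (Cod C r)"
    and "tot (lunit A p) = lunit C (Dom C p)" "st (lunit A p) = lunit C (Cod C p)"
    and "tot (runit A p) = runit C (Dom C p)" "st (runit A p) = runit C (Cod C p)"
  by (simp_all add: operations)

text \<open>Objects of \<open>A\<close> are arrows of \<open>C\<close>, and tensoring them as
  objects is tensoring them as arrows; the two recursions coincide.\<close>

lemma bigtens_obj_A: "bigtens_obj A B xs = bigtens_arr C B xs"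
  by (induction xs) auto

text \<open>Every operation of \<open>A\<close> acts componentwise, so each axiom is the one for
  \<open>F\<close> at the total components.\<close>

lemma tot_fun_strong_monoidal:
  assumes "strong_monoidal_functor C D F"
  shows "strong_monoidal_functor A D (tot_fun C F)"
proof -
  interpret F: strong_monoidal_functor C D F by fact
  have 1: "f \<in> hom A a b \<Longrightarrow> tot f \<in> hom C (Dom C a) (Dom C b)" for f a b
    by (auto simp: hom_def)
  show ?thesis
  proof unfold_locales
    fix a a' b b' f g assume "f \<in> hom A a a'" "g \<in> hom A b b'"
    then show "fmult (tot_fun C F) a' b' \<cdot>\<^bsub>D\<^esub> (farr (tot_fun C F) f \<otimes>\<^bsub>D\<^esub> farr (tot_fun C F) g)
      = farr (tot_fun C F) (f \<otimes>\<^bsub>A\<^esub> g) \<cdot>\<^bsub>D\<^esub> fmult (tot_fun C F) a b"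
      using F.fmult_nat[OF 1 1] by (simp add: tot_fun_def)
  qed (auto simp: tot_fun_def F.farr_id F.farr_comp[OF 1 1] F.fmult_iso F.funit_iso F.fmult_assoc
      F.fmult_lunit F.fmult_runit intro: F.farr_hom 1 F.fmult_hom F.funit_hom)
qed

lemma st_fun_strong_monoidal:
  assumes "strong_monoidal_functor C D F"
  shows "strong_monoidal_functor A D (st_fun C F)"
proof -
  interpret F: strong_monoidal_functor C D F by fact
  have 1: "f \<in> hom A a b \<Longrightarrow> st f \<in> hom C (Cod C a) (Cod C b)" for f a b
    by (auto simp: hom_def)
  show ?thesis
  proof unfold_locales
    fix a a' b b' f g assume "f \<in> hom A a a'" "g \<in> hom A b b'"
    then show "fmult (st_fun C F) a' b' \<cdot>\<^bsub>D\<^esub> (farr (st_fun C F) f \<otimes>\<^bsub>D\<^esub> farr (st_fun C F) g)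
      = farr (st_fun C F) (f \<otimes>\<^bsub>A\<^esub> g) \<cdot>\<^bsub>D\<^esub> fmult (st_fun C F) a b"
      using F.fmult_nat[OF 1 1] by (simp add: st_fun_def)
  qed (auto simp: st_fun_def F.farr_id F.farr_comp[OF 1 1] F.fmult_iso F.funit_iso F.fmult_assoc
      F.fmult_lunit F.fmult_runit intro: F.farr_hom 1 F.fmult_hom F.funit_hom)
qed

text \<open>The domain of a tensor of arrows is the tensor of their domains. This identifies the
  comparison map of the composite functor with the one occurring in \<open>parallel\<close>.\<close>

lemma bigmult_tot_fun:
  assumes "\<forall>x\<in>set xs. B x \<in> Obj A"
  shows "bigmult A D (tot_fun C F) B xs = bigmult C D F (\<lambda>x. Dom C (B x)) xs"
  using assms
  by (induction xs) (simp_all add: tot_fun_def bigtens_obj_A C.bigtens_arr_simps)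

lemma bigmult_st_fun:
  assumes "\<forall>x\<in>set xs. B x \<in> Obj A"
  shows "bigmult A D (st_fun C F) B xs = bigmult C D F (\<lambda>x. Cod C (B x)) xs"
  using assms
  by (induction xs) (simp_all add: st_fun_def bigtens_obj_A C.bigtens_arr_simps)

end


section \<open>Open sections of products\<close>

locale open_systems =
  D: cartesian_monoidal_category D + monoidal_nat_trans C D T U \<tau> +
  arrow_subcategory C A + A: cartesian_monoidal_category A
  for C :: "('o, 'm) moncat" and D :: "('p, 'n) moncat"
    and T U :: "('o, 'm, 'p, 'n) monfun" and \<tau> :: "'o \<Rightarrow> 'n" and A :: "('m, 'm square) moncat"
begin

text \<open>A section goes from \<open>U\<close> of a total object to \<open>T\<close> of a state
  object, so \<open>U\<close> on totals and \<open>T\<close> on states are the functors whose action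
  on projections matters.\<close>

sublocale tot: cartesian_monoidal_functor A D "tot_fun C U"
  by (intro cartesian_monoidal_functor.intro tot_fun_strong_monoidal) unfold_locales

sublocale st: cartesian_monoidal_functor A D "st_fun C T"
  by (intro cartesian_monoidal_functor.intro st_fun_strong_monoidal) unfold_locales

abbreviation "\<Gamma> \<equiv> sections C D T U \<tau>"

lemma sectionsD:
  assumes "X \<in> \<Gamma> a"
  shows "X \<in> Arr D" "Dom D X = fobj U (Dom C a)" "Cod D X = fobj T (Cod C a)"
    "\<tau> (Cod C a) \<cdot>\<^bsub>D\<^esub> X = farr U a"
  using assms unfolding sections_def hom_def by blast+

lemma sections_prodD: "v \<in> sections_prod C D T U \<tau> F \<Longrightarrow> x \<in> idx F \<Longrightarrow> v x \<in> \<Gamma> (memb F x)"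
  by (auto simp: sections_prod_def)

text \<open>The section equation is tested after the isomorphism \<open>farr U (st i)\<close>.
  Naturality of \<open>\<tau>\<close> turns this into \<open>farr T (st i)\<close>, which cancels
  the inverse inside \<open>sections_map\<close>.\<close>

lemma sections_map_section:
  assumes i: "interconnection C A a b i" and Y: "Y \<in> \<Gamma> b"
  shows "sections_map D T U i Y \<in> \<Gamma> a"
proof -
  have iso: "is_iso C (st i)" and A: "i \<in> Arr A" "Dom A i = a" "Cod A i = b"
    using i by (auto simp: interconnection_def hom_def)
  have ab: "a \<in> Arr C" "b \<in> Arr C" using A.dom_obj A.cod_obj A by force+
  note [simp] = A ab sectionsD[OF Y] T.farr_iso[OF iso] U.farr_iso[OF iso]
  let ?X = "sections_map D T U i Y"
  have X: "?X \<in> Arr D" "Dom D ?X = fobj U (Dom C a)" "Cod D ?X = fobj T (Cod C a)"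
    by (simp_all add: sections_map_def)
  have "farr U (st i) \<cdot>\<^bsub>D\<^esub> (\<tau> (Cod C a) \<cdot>\<^bsub>D\<^esub> ?X)
      = (\<tau> (Cod C b) \<cdot>\<^bsub>D\<^esub> farr T (st i)) \<cdot>\<^bsub>D\<^esub> ?X"
    using X naturality[OF hom_self[of "st i" C]] by (simp add: D.assoc_comp)
  also have "\<dots> = \<tau> (Cod C b) \<cdot>\<^bsub>D\<^esub> (farr T (st i) \<cdot>\<^bsub>D\<^esub> inv_arr D (farr T (st i)))
      \<cdot>\<^bsub>D\<^esub> (Y \<cdot>\<^bsub>D\<^esub> farr U (tot i))"
    by (simp add: sections_map_def D.assoc_comp del: D.inv_arr_simps(5))
  also have "\<dots> = \<tau> (Cod C b) \<cdot>\<^bsub>D\<^esub> Y \<cdot>\<^bsub>D\<^esub> farr U (tot i)"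
    by (simp add: D.assoc_comp del: sectionsD(4)[OF Y])
  \<comment> \<open>\<open>Y\<close> being a section replaces \<open>\<tau>\<close> after
    \<open>Y\<close> by \<open>farr U b\<close>; the commuting square \<open>i\<close> then
    exchanges \<open>b\<close> for \<open>a\<close>.\<close>
  also have "\<dots> = farr U (st i) \<cdot>\<^bsub>D\<^esub> farr U a"
    using square_commutes[OF A(1)] by (simp add: U.farr_comp'[symmetric])
  finally have "\<tau> (Cod C a) \<cdot>\<^bsub>D\<^esub> ?X = farr U a"
    by (rule D.iso_cancel_left[of "farr U (st i)", rotated -1]) (use X in simp_all)
  then show ?thesis using X by (simp add: sections_def hom_def)
qed

context
  fixes F :: "('x, 'm) family"
  assumes F: "is_list A F"
begin

lemma list_memb: "\<forall>x\<in>set (enum F). memb F x \<in> Obj A"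
  and list_memb_C: "\<forall>x\<in>set (enum F). memb F x \<in> Arr C"
  using F by (auto simp: is_list_def idx_def)

lemma list_prod_eq: "list_prod A F = bigtens_arr C (memb F) (enum F)"
  by (simp add: list_prod_def bigtens_obj_A)

lemma list_prod_obj: "list_prod A F \<in> Obj A"
  using list_memb by (simp add: list_prod_def del: tens_obj_A unit_obj_A)

lemma list_proj_simps:
  assumes "x \<in> idx F"
  shows "list_proj A F x \<in> Arr A" "Dom A (list_proj A F x) = list_prod A F"
    "Cod A (list_proj A F x) = memb F x"
  using assms A.bigproj_simps[OF list_memb] by (auto simp: list_proj_def list_prod_def idx_def)

text \<open>Up to the invertible comparison map of \<open>T\<close>, these arrows are the
  projections of an iterated product in \<open>D\<close>, which are jointly monic by
  \<open>bigproj_eqI\<close>.\<close>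

lemma state_proj_monic:
  assumes "X \<in> Arr D" "Y \<in> Arr D" "Dom D X = Dom D Y"
    and "Cod D X = fobj T (Cod C (list_prod A F))" "Cod D Y = fobj T (Cod C (list_prod A F))"
    and "\<And>x. x \<in> idx F \<Longrightarrow> farr T (st (list_proj A F x)) \<cdot>\<^bsub>D\<^esub> X = farr T (st (list_proj A F x)) \<cdot>\<^bsub>D\<^esub> Y"
  shows "X = Y"
proof -
  let ?m = "bigmult A D (st_fun C T) (memb F) (enum F)"
  let ?Q = "bigtens_obj D (\<lambda>x. fobj (st_fun C T) (memb F x)) (enum F)"
  have m: "?m \<in> Arr D" "Dom D ?m = ?Q" "Cod D ?m = fobj T (Cod C (list_prod A F))"
    and iso: "is_iso D ?m"
    using st.bigmult_simps[OF list_memb] st.bigmult_iso[OF list_memb]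
    by (simp_all add: list_prod_def st_fun_def)
  note [simp] = m assms(1-5) D.inv_arr_simps(1-3)[OF iso]
  have proj: "bigproj D (\<lambda>x. fobj (st_fun C T) (memb F x)) (enum F) x \<cdot>\<^bsub>D\<^esub> (inv_arr D ?m \<cdot>\<^bsub>D\<^esub> Z)
      = farr T (st (list_proj A F x)) \<cdot>\<^bsub>D\<^esub> Z"
    if "x \<in> idx F" "Z \<in> Arr D" "Cod D Z = fobj T (Cod C (list_prod A F))" for x Z
  proof -
    have "bigproj D (\<lambda>x. fobj (st_fun C T) (memb F x)) (enum F) x
        = farr T (st (list_proj A F x)) \<cdot>\<^bsub>D\<^esub> ?m"
      using st.farr_bigproj[OF list_memb] that(1) by (simp add: list_proj_def st_fun_def idx_def)
    moreover have "?m \<cdot>\<^bsub>D\<^esub> (inv_arr D ?m \<cdot>\<^bsub>D\<^esub> Z) = Z"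
      using that iso by (simp add: D.assoc_comp[symmetric])
    ultimately show ?thesis using that list_proj_simps[OF that(1)] by (simp add: D.assoc_comp)
  qed
  have "inv_arr D ?m \<cdot>\<^bsub>D\<^esub> X = inv_arr D ?m \<cdot>\<^bsub>D\<^esub> Y"
  proof (rule D.bigproj_eqI)
    show "distinct (enum F)" using F by (simp add: is_list_def)
    show "\<forall>x\<in>set (enum F). fobj (st_fun C T) (memb F x) \<in> Obj D" using list_memb by simp
    show "inv_arr D ?m \<cdot>\<^bsub>D\<^esub> X \<in> hom D (Dom D X) ?Q" "inv_arr D ?m \<cdot>\<^bsub>D\<^esub> Y \<in> hom D (Dom D X) ?Q"
      by (auto intro!: homI)
  qed (use assms(6) in \<open>simp add: proj idx_def\<close>)
  then have "?m \<cdot>\<^bsub>D\<^esub> inv_arr D ?m \<cdot>\<^bsub>D\<^esub> X = ?m \<cdot>\<^bsub>D\<^esub> inv_arr D ?m \<cdot>\<^bsub>D\<^esub> Y"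
    by (simp add: D.assoc_comp)
  then show ?thesis using iso by simp
qed

section \<open>The parallel composite of a family of sections\<close>

context
  fixes v assumes v: "v \<in> sections_prod C D T U \<tau> F"
begin

lemma memb_section: "x \<in> set (enum F) \<Longrightarrow> v x \<in> \<Gamma> (memb F x)"
  using sections_prodD[OF v] by (simp add: idx_def)

lemma bigtens_sections:
  shows "bigtens_arr D v (enum F) \<in> Arr D"
    and "Dom D (bigtens_arr D v (enum F)) = bigtens_obj D (\<lambda>x. fobj U (Dom C (memb F x))) (enum F)"
    and "Cod D (bigtens_arr D v (enum F)) = bigtens_obj D (\<lambda>x. fobj T (Cod C (memb F x))) (enum F)"
proof -
  have 1: "\<forall>x\<in>set (enum F). v x \<in> Arr D" using memb_section sectionsD(1) by blast
  show "bigtens_arr D v (enum F) \<in> Arr D"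
    "Dom D (bigtens_arr D v (enum F)) = bigtens_obj D (\<lambda>x. fobj U (Dom C (memb F x))) (enum F)"
    "Cod D (bigtens_arr D v (enum F)) = bigtens_obj D (\<lambda>x. fobj T (Cod C (memb F x))) (enum F)"
    unfolding D.bigtens_arr_simps[OF 1]
    using D.bigtens_arr_simps[OF 1] by (auto intro!: bigtens_obj_cong simp: sectionsD[OF memb_section])
qed

lemma parallel_factors:
  defines "m \<equiv> bigmult C D T (\<lambda>x. Cod C (memb F x)) (enum F)"
    and "n \<equiv> bigmult C D U (\<lambda>x. Dom C (memb F x)) (enum F)"
  shows "m \<in> Arr D" "Dom D m = bigtens_obj D (\<lambda>x. fobj T (Cod C (memb F x))) (enum F)"
    "Cod D m = fobj T (Cod C (list_prod A F))"
    and "n \<in> Arr D" "Dom D n = bigtens_obj D (\<lambda>x. fobj U (Dom C (memb F x))) (enum F)"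
    "Cod D n = fobj U (Dom C (list_prod A F))" "is_iso D n"
    and "parallel C D T U F v = m \<cdot>\<^bsub>D\<^esub> bigtens_arr D v (enum F) \<cdot>\<^bsub>D\<^esub> inv_arr D n"
proof -
  have 1: "\<forall>x\<in>set (enum F). Cod C (memb F x) \<in> Obj C" "\<forall>x\<in>set (enum F). Dom C (memb F x) \<in> Obj C"
    using list_memb by auto
  show "m \<in> Arr D" "Dom D m = bigtens_obj D (\<lambda>x. fobj T (Cod C (memb F x))) (enum F)"
    "Cod D m = fobj T (Cod C (list_prod A F))"
    "n \<in> Arr D" "Dom D n = bigtens_obj D (\<lambda>x. fobj U (Dom C (memb F x))) (enum F)"
    "Cod D n = fobj U (Dom C (list_prod A F))" "is_iso D n"
    "parallel C D T U F v = m \<cdot>\<^bsub>D\<^esub> bigtens_arr D v (enum F) \<cdot>\<^bsub>D\<^esub> inv_arr D n"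
    using T.bigmult_simps[OF 1(1)] U.bigmult_simps[OF 1(2)] U.bigmult_iso[OF 1(2)]
      T.C.bigtens_arr_simps[OF list_memb_C]
    by (simp_all add: m_def n_def parallel_def list_prod_eq)
qed

text \<open>\<open>bigmult_compat\<close> moves \<open>\<tau>\<close> past the comparison map of
  \<open>T\<close>, each factor contributes its own section equation, and \<open>bigmult_nat\<close>
  reassembles the factors into \<open>U\<close> of the product.\<close>

lemma parallel_section: "parallel C D T U F v \<in> \<Gamma> (list_prod A F)"
proof -
  let ?P = "list_prod A F"
  let ?m = "bigmult C D T (\<lambda>x. Cod C (memb F x)) (enum F)"
  let ?n = "bigmult C D U (\<lambda>x. Dom C (memb F x)) (enum F)"
  \<comment> \<open>The comparison map of \<open>U\<close> at the state objects:
    \<open>\<tau>\<close> replaces \<open>T\<close> of states by \<open>U\<close> of states, whereas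
    \<open>?n\<close> concerns the total objects.\<close>
  let ?k = "bigmult C D U (\<lambda>x. Cod C (memb F x)) (enum F)"
  let ?v = "bigtens_arr D v (enum F)" and ?t = "bigtens_arr D (\<lambda>x. \<tau> (Cod C (memb F x))) (enum F)"
  have c: "\<forall>x\<in>set (enum F). Cod C (memb F x) \<in> Obj C" using list_memb by auto
  have P: "?P \<in> Arr C" using list_prod_obj by simp
  have PC: "Cod C ?P = bigtens_obj C (\<lambda>x. Cod C (memb F x)) (enum F)"
    using T.C.bigtens_arr_simps[OF list_memb_C] by (simp add: list_prod_eq)
  have 1: "\<forall>x\<in>set (enum F). \<tau> (Cod C (memb F x)) \<in> Arr D" using c by auto
  have t: "?t \<in> Arr D" "Dom D ?t = Cod D ?v" "Cod D ?t = Dom D ?k"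
    unfolding D.bigtens_arr_simps[OF 1] bigtens_sections U.bigmult_simps[OF c]
    using D.bigtens_arr_simps[OF 1] c by (auto intro!: bigtens_obj_cong)
  note [simp] = parallel_factors bigtens_sections t(1) t(2)[unfolded bigtens_sections]
    t(3)[unfolded U.bigmult_simps[OF c]] P U.bigmult_simps[OF c]
  have "\<tau> (Cod C ?P) \<cdot>\<^bsub>D\<^esub> (?m \<cdot>\<^bsub>D\<^esub> ?v) = (\<tau> (Cod C ?P) \<cdot>\<^bsub>D\<^esub> ?m) \<cdot>\<^bsub>D\<^esub> ?v"
    by (simp add: D.assoc_comp)
  also have "\<dots> = ?k \<cdot>\<^bsub>D\<^esub> (?t \<cdot>\<^bsub>D\<^esub> ?v)"
    unfolding PC bigmult_compat[OF c] by (simp add: D.assoc_comp)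
  also have "?t \<cdot>\<^bsub>D\<^esub> ?v = bigtens_arr D (\<lambda>x. \<tau> (Cod C (memb F x)) \<cdot>\<^bsub>D\<^esub> v x) (enum F)"
    using c sectionsD(1-3)[OF memb_section] by (intro D.bigtens_arr_comp) auto
  also have "\<dots> = bigtens_arr D (\<lambda>x. farr U (memb F x)) (enum F)"
    using sectionsD(4)[OF memb_section] by (rule bigtens_arr_cong)
  also have "?k \<cdot>\<^bsub>D\<^esub> \<dots> = farr U ?P \<cdot>\<^bsub>D\<^esub> ?n"
    using U.bigmult_nat[OF list_memb_C] by (simp add: list_prod_eq)
  finally have *: "\<tau> (Cod C ?P) \<cdot>\<^bsub>D\<^esub> (?m \<cdot>\<^bsub>D\<^esub> ?v) = farr U ?P \<cdot>\<^bsub>D\<^esub> ?n" .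
  have "\<tau> (Cod C ?P) \<cdot>\<^bsub>D\<^esub> parallel C D T U F v = \<tau> (Cod C ?P) \<cdot>\<^bsub>D\<^esub> (?m \<cdot>\<^bsub>D\<^esub> ?v) \<cdot>\<^bsub>D\<^esub> inv_arr D ?n"
    by (simp add: D.assoc_comp)
  also have "\<dots> = farr U ?P"
    unfolding * by (simp add: D.assoc_comp)
  finally show ?thesis by (simp add: sections_def hom_def)
qed

text \<open>Through the comparison maps, both projections become projections of iterated products in
  \<open>D\<close>, and those are natural with respect to the tensor of the sections.\<close>

lemma parallel_proj:
  assumes x: "x \<in> idx F"
  shows "farr T (st (list_proj A F x)) \<cdot>\<^bsub>D\<^esub> parallel C D T U F v
    = v x \<cdot>\<^bsub>D\<^esub> farr U (tot (list_proj A F x))"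
proof -
  let ?P = "list_prod A F" and ?v = "bigtens_arr D v (enum F)"
  let ?m = "bigmult C D T (\<lambda>x. Cod C (memb F x)) (enum F)"
  let ?n = "bigmult C D U (\<lambda>x. Dom C (memb F x)) (enum F)"
  let ?p = "bigproj D (\<lambda>x. fobj T (Cod C (memb F x))) (enum F) x"
  let ?q = "bigproj D (\<lambda>x. fobj U (Dom C (memb F x))) (enum F) x"
  have x': "x \<in> set (enum F)" using x by (simp add: idx_def)
  have P: "?P \<in> Arr C" using list_prod_obj by simp
  have p: "farr T (st (list_proj A F x)) \<cdot>\<^bsub>D\<^esub> ?m = ?p"
    using st.farr_bigproj[OF list_memb x'] list_memb
    by (simp add: list_proj_def st_fun_def bigmult_st_fun[unfolded st_fun_def])
  have q: "farr U (tot (list_proj A F x)) \<cdot>\<^bsub>D\<^esub> ?n = ?q"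
    using tot.farr_bigproj[OF list_memb x'] list_memb
    by (simp add: list_proj_def tot_fun_def bigmult_tot_fun[unfolded tot_fun_def])
  have "bigproj D (\<lambda>x. Cod D (v x)) (enum F) x \<cdot>\<^bsub>D\<^esub> ?v = v x \<cdot>\<^bsub>D\<^esub> bigproj D (\<lambda>x. Dom D (v x)) (enum F) x"
    using sectionsD(1)[OF memb_section] x' by (intro D.bigproj_nat) auto
  \<comment> \<open>\<open>bigproj_nat\<close> speaks of the domains and codomains of the
    \<open>v x\<close>; on the list these are the \<open>U\<close> and \<open>T\<close> images of
    totals and states.\<close>
  moreover have "bigproj D (\<lambda>x. Cod D (v x)) (enum F) x = ?p"
    "bigproj D (\<lambda>x. Dom D (v x)) (enum F) x = ?q"
    by (intro bigproj_cong sectionsD memb_section; simp)+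
  ultimately have pv: "?p \<cdot>\<^bsub>D\<^esub> ?v = v x \<cdot>\<^bsub>D\<^esub> ?q" by simp
  note [simp] = parallel_factors bigtens_sections P list_proj_simps[OF x]
    sectionsD(1-3)[OF memb_section[OF x']]
  have "farr T (st (list_proj A F x)) \<cdot>\<^bsub>D\<^esub> parallel C D T U F v
    = (farr T (st (list_proj A F x)) \<cdot>\<^bsub>D\<^esub> ?m) \<cdot>\<^bsub>D\<^esub> ?v \<cdot>\<^bsub>D\<^esub> inv_arr D ?n"
    by (simp add: D.assoc_comp)
  also have "\<dots> = v x \<cdot>\<^bsub>D\<^esub> (farr U (tot (list_proj A F x)) \<cdot>\<^bsub>D\<^esub> ?n) \<cdot>\<^bsub>D\<^esub> inv_arr D ?n"
    unfolding p pv q ..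
  also have "\<dots> = v x \<cdot>\<^bsub>D\<^esub> farr U (tot (list_proj A F x))"
    by (simp add: D.assoc_comp)
  finally show ?thesis .
qed

end

end

section \<open>Maps between products, and transport of relatedness\<close>

lemma list_prod_map_props:
  assumes "list_morphism A F G \<phi> \<Phi>"
  defines "h \<equiv> list_prod_map A F G \<phi> \<Phi>"
  shows "h \<in> Arr A" "Dom A h = list_prod A G" "Cod A h = list_prod A F"
    and "\<And>x. x \<in> idx F \<Longrightarrow> list_proj A F x \<cdot>\<^bsub>A\<^esub> h = \<Phi> x \<cdot>\<^bsub>A\<^esub> list_proj A G (\<phi> x)"
proof -
  have F: "is_list A F" and G: "is_list A G" and \<phi>: "\<And>x. x \<in> idx F \<Longrightarrow> \<phi> x \<in> idx G"
    and \<Phi>: "\<And>x. x \<in> idx F \<Longrightarrow> \<Phi> x \<in> hom A (memb G (\<phi> x)) (memb F x)"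
    using assms(1) by (auto simp: list_morphism_def)
  let ?R = "\<lambda>h. h \<in> hom A (list_prod A G) (list_prod A F) \<and>
    (\<forall>x \<in> idx F. list_proj A F x \<cdot>\<^bsub>A\<^esub> h = \<Phi> x \<cdot>\<^bsub>A\<^esub> list_proj A G (\<phi> x))"
  have d: "distinct (enum F)" using F by (simp add: is_list_def)
  \<comment> \<open>Existence comes from lifting the family on the right of the defining equation,
    uniqueness from joint monicity of the projections; together they justify the description in
    \<open>list_prod_map\<close>.\<close>
  have "\<exists>h. ?R h"
    using A.bigproj_lift[OF d _ list_memb[OF F] list_prod_obj[OF G],
        of "\<lambda>x. \<Phi> x \<cdot>\<^bsub>A\<^esub> list_proj A G (\<phi> x)"] \<Phi> list_proj_simps[OF G \<phi>]
    by (fastforce simp: list_prod_def list_proj_def idx_def hom_def)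
  moreover have "h = k" if "?R h" "?R k" for h k
    by (rule A.bigproj_eqI[OF d list_memb[OF F]])
      (use that in \<open>auto simp: list_prod_def list_proj_def idx_def\<close>)
  ultimately have "\<exists>!h. ?R h" by blast
  from theI'[OF this] have "?R h" unfolding h_def list_prod_map_def .
  then show "h \<in> Arr A" "Dom A h = list_prod A G" "Cod A h = list_prod A F"
    "\<And>x. x \<in> idx F \<Longrightarrow> list_proj A F x \<cdot>\<^bsub>A\<^esub> h = \<Phi> x \<cdot>\<^bsub>A\<^esub> list_proj A G (\<phi> x)"
    by (auto simp: hom_def)
qed

text \<open>By \<open>state_proj_monic\<close> one index \<open>x\<close> suffices, and there
  \<open>parallel_proj\<close> reduces the claim to relatedness of \<open>w (\<phi> x)\<close> and
  \<open>v x\<close>. Since \<open>\<phi>\<close> may repeat values, one entry of \<open>w\<close>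
  can serve several \<open>x\<close>.\<close>

lemma parallel_related:
  assumes "list_morphism A F G \<phi> \<Phi>" and wv: "(w, v) \<in> sections_list_rel C D T U \<tau> F G \<phi> \<Phi>"
  shows "(parallel C D T U G w, parallel C D T U F v)
    \<in> sections_rel C D T U \<tau> (list_prod_map A F G \<phi> \<Phi>)"
proof -
  let ?h = "list_prod_map A F G \<phi> \<Phi>"
  let ?W = "parallel C D T U G w" and ?V = "parallel C D T U F v"
  have F: "is_list A F" and G: "is_list A G" and \<phi>: "\<And>x. x \<in> idx F \<Longrightarrow> \<phi> x \<in> idx G"
    and \<Phi>: "\<And>x. x \<in> idx F \<Longrightarrow> \<Phi> x \<in> hom A (memb G (\<phi> x)) (memb F x)"
    using assms(1) by (auto simp: list_morphism_def)
  have w: "w \<in> sections_prod C D T U \<tau> G" and v: "v \<in> sections_prod C D T U \<tau> F"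
    and rel: "\<And>x. x \<in> idx F \<Longrightarrow>
      farr T (st (\<Phi> x)) \<cdot>\<^bsub>D\<^esub> w (\<phi> x) = v x \<cdot>\<^bsub>D\<^esub> farr U (tot (\<Phi> x))"
    using wv by (auto simp: sections_list_rel_def sections_rel_def)
  note h = list_prod_map_props[OF assms(1)]
  note W = parallel_section[OF G w] and V = parallel_section[OF F v]
  note [simp] = h(1-3) sectionsD(1-3)[OF W] sectionsD(1-3)[OF V]
  have "farr T (st ?h) \<cdot>\<^bsub>D\<^esub> ?W = ?V \<cdot>\<^bsub>D\<^esub> farr U (tot ?h)"
  proof (rule state_proj_monic[OF F])
    fix x assume x: "x \<in> idx F"
    let ?p = "list_proj A F x" and ?q = "list_proj A G (\<phi> x)"
    note [simp] = list_proj_simps[OF F x] list_proj_simps[OF G \<phi>[OF x]] homD[OF \<Phi>[OF x]]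
      sectionsD(1-3)[OF sections_prodD[OF v x]] sectionsD(1-3)[OF sections_prodD[OF w \<phi>[OF x]]]
    \<comment> \<open>The state and total components of the equation characterising the map of
      products; \<open>T\<close> is applied to the first and \<open>U\<close> to the second.\<close>
    have st: "st ?p \<cdot>\<^bsub>C\<^esub> st ?h = st (\<Phi> x) \<cdot>\<^bsub>C\<^esub> st ?q"
      and tot: "tot ?p \<cdot>\<^bsub>C\<^esub> tot ?h = tot (\<Phi> x) \<cdot>\<^bsub>C\<^esub> tot ?q"
      using arg_cong[OF h(4)[OF x], of st] arg_cong[OF h(4)[OF x], of tot] by simp_all
    have "farr T (st ?p) \<cdot>\<^bsub>D\<^esub> (farr T (st ?h) \<cdot>\<^bsub>D\<^esub> ?W) = farr T (st ?p \<cdot>\<^bsub>C\<^esub> st ?h) \<cdot>\<^bsub>D\<^esub> ?W"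
      by (simp add: T.farr_comp' D.assoc_comp)
    also have "\<dots> = farr T (st (\<Phi> x)) \<cdot>\<^bsub>D\<^esub> (farr T (st ?q) \<cdot>\<^bsub>D\<^esub> ?W)"
      unfolding st by (simp add: T.farr_comp' D.assoc_comp)
    also have "\<dots> = (farr T (st (\<Phi> x)) \<cdot>\<^bsub>D\<^esub> w (\<phi> x)) \<cdot>\<^bsub>D\<^esub> farr U (tot ?q)"
      unfolding parallel_proj[OF G w \<phi>[OF x]] by (simp add: D.assoc_comp)
    also have "\<dots> = v x \<cdot>\<^bsub>D\<^esub> farr U (tot (\<Phi> x) \<cdot>\<^bsub>C\<^esub> tot ?q)"
      unfolding rel[OF x] by (simp add: U.farr_comp' D.assoc_comp)
    also have "\<dots> = (v x \<cdot>\<^bsub>D\<^esub> farr U (tot ?p)) \<cdot>\<^bsub>D\<^esub> farr U (tot ?h)"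
      unfolding tot[symmetric] by (simp add: U.farr_comp' D.assoc_comp)
    also have "\<dots> = farr T (st ?p) \<cdot>\<^bsub>D\<^esub> (?V \<cdot>\<^bsub>D\<^esub> farr U (tot ?h))"
      unfolding parallel_proj[OF F v x, symmetric] by (simp add: D.assoc_comp)
    finally show "farr T (st ?p) \<cdot>\<^bsub>D\<^esub> (farr T (st ?h) \<cdot>\<^bsub>D\<^esub> ?W)
      = farr T (st ?p) \<cdot>\<^bsub>D\<^esub> (?V \<cdot>\<^bsub>D\<^esub> farr U (tot ?h))" .
  qed simp_all
  then show ?thesis using W V h(2,3) by (simp add: sections_rel_def operations)
qed

text \<open>After \<open>farr T (st i)\<close> both sides can be compared through the commuting
  square \<open>eq\<close>: its state part moves to \<open>h\<close> and \<open>j\<close>,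
  relatedness along \<open>h\<close> switches from \<open>T\<close> to \<open>U\<close>, and its
  total part leads back to \<open>i\<close> and \<open>f\<close>.\<close>

lemma sections_map_related:
  assumes i: "interconnection C A a b i" and j: "interconnection C A a' b' j"
    and f: "f \<in> hom A a' a" and h: "h \<in> hom A b' b" and eq: "i \<cdot>\<^bsub>A\<^esub> f = h \<cdot>\<^bsub>A\<^esub> j"
    and YX: "(Y, X) \<in> sections_rel C D T U \<tau> h"
  shows "(sections_map D T U j Y, sections_map D T U i X) \<in> sections_rel C D T U \<tau> f"
proof -
  note fh = homD[OF f] homD[OF h]
  have iso: "is_iso C (st i)" "is_iso C (st j)"
    and A: "i \<in> Arr A" "Dom A i = a" "Cod A i = b" "j \<in> Arr A" "Dom A j = a'" "Cod A j = b'"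
    using i j by (auto simp: interconnection_def hom_def)
  have Y: "Y \<in> \<Gamma> b'" and X: "X \<in> \<Gamma> b" and r: "farr T (st h) \<cdot>\<^bsub>D\<^esub> Y = X \<cdot>\<^bsub>D\<^esub> farr U (tot h)"
    using YX fh by (auto simp: sections_rel_def operations)
  let ?Y = "sections_map D T U j Y" and ?X = "sections_map D T U i X"
  note S = sections_map_section[OF i X] sections_map_section[OF j Y]
  have ab: "a \<in> Arr C" "b \<in> Arr C" "a' \<in> Arr C" "b' \<in> Arr C" using A.dom_obj A.cod_obj A by force+
  note [simp] = fh A ab sectionsD(1-3)[OF X] sectionsD(1-3)[OF Y] sectionsD(1-3)[OF S(1)]
    sectionsD(1-3)[OF S(2)] T.farr_iso[OF iso(1)] T.farr_iso[OF iso(2)]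
  have st: "st i \<cdot>\<^bsub>C\<^esub> st f = st h \<cdot>\<^bsub>C\<^esub> st j" and tot: "tot i \<cdot>\<^bsub>C\<^esub> tot f = tot h \<cdot>\<^bsub>C\<^esub> tot j"
    using arg_cong[OF eq, of st] arg_cong[OF eq, of tot] by simp_all
  \<comment> \<open>\<open>farr T (st i)\<close> undoes the inverse in \<open>sections_map\<close>;
    the instance of associativity puts the two next to each other.\<close>
  have mX: "farr T (st i) \<cdot>\<^bsub>D\<^esub> ?X = X \<cdot>\<^bsub>D\<^esub> farr U (tot i)"
    using D.assoc_comp[of "X \<cdot>\<^bsub>D\<^esub> farr U (tot i)" "inv_arr D (farr T (st i))" "farr T (st i)"]
    by (simp add: sections_map_def D.assoc_comp)
  have mY: "farr T (st j) \<cdot>\<^bsub>D\<^esub> ?Y = Y \<cdot>\<^bsub>D\<^esub> farr U (tot j)"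
    using D.assoc_comp[of "Y \<cdot>\<^bsub>D\<^esub> farr U (tot j)" "inv_arr D (farr T (st j))" "farr T (st j)"]
    by (simp add: sections_map_def D.assoc_comp)
  have "farr T (st i) \<cdot>\<^bsub>D\<^esub> (farr T (st f) \<cdot>\<^bsub>D\<^esub> ?Y) = farr T (st i \<cdot>\<^bsub>C\<^esub> st f) \<cdot>\<^bsub>D\<^esub> ?Y"
    by (simp add: T.farr_comp' D.assoc_comp)
  also have "\<dots> = farr T (st h) \<cdot>\<^bsub>D\<^esub> (farr T (st j) \<cdot>\<^bsub>D\<^esub> ?Y)"
    unfolding st by (simp add: T.farr_comp' D.assoc_comp)
  also have "\<dots> = (farr T (st h) \<cdot>\<^bsub>D\<^esub> Y) \<cdot>\<^bsub>D\<^esub> farr U (tot j)"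
    unfolding mY by (simp add: D.assoc_comp)
  also have "\<dots> = X \<cdot>\<^bsub>D\<^esub> farr U (tot h \<cdot>\<^bsub>C\<^esub> tot j)"
    unfolding r by (simp add: U.farr_comp' D.assoc_comp)
  also have "\<dots> = (X \<cdot>\<^bsub>D\<^esub> farr U (tot i)) \<cdot>\<^bsub>D\<^esub> farr U (tot f)"
    unfolding tot[symmetric] by (simp add: U.farr_comp' D.assoc_comp)
  also have "\<dots> = farr T (st i) \<cdot>\<^bsub>D\<^esub> (?X \<cdot>\<^bsub>D\<^esub> farr U (tot f))"
    unfolding mX[symmetric] by (simp add: D.assoc_comp)
  finally have "farr T (st f) \<cdot>\<^bsub>D\<^esub> ?Y = ?X \<cdot>\<^bsub>D\<^esub> farr U (tot f)"
    by (rule D.iso_cancel_left[of "farr T (st i)", rotated -1]) simp_all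
  then show ?thesis using S fh by (simp add: sections_rel_def operations)
qed

end

theorem theorem4p3p17:
  fixes C :: "('o, 'm) moncat" and D :: "('p, 'n) moncat"
    and K\<^sub>C :: "('o, 'm, 'u set, 'u set \<times> ('u \<Rightarrow> 'u) \<times> 'u set) func"
    and K\<^sub>D :: "('p, 'n, 'v set, 'v set \<times> ('v \<Rightarrow> 'v) \<times> 'v set) func"
    and T U :: "('o, 'm, 'p, 'n) monfun" and \<tau> :: "'o \<Rightarrow> 'n"
    and A :: "('m, 'm square) moncat"
    and \<A>\<^sub>X :: "('x, 'm) family" and \<A>\<^sub>Y :: "('y, 'm) family"
    and a a' :: "'m" and \<iota>\<^sub>X \<iota>\<^sub>Y f :: "'m square"
    and \<phi> :: "'x \<Rightarrow> 'y" and \<Phi> :: "'x \<Rightarrow> 'm square"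
  assumes "monoidal_category C" and "concrete_category C K\<^sub>C"
    and "cartesian_monoidal_category D" and "concrete_category D K\<^sub>D"
    and "strong_monoidal_functor C D T" and "strong_monoidal_functor C D U"
    and "monoidal_nat_trans C D T U \<tau>" and "fibered C D \<tau>"
    and "cartesian_monoidal_subcategory A (arrow_cat C)"
    and "network_morphism C A \<A>\<^sub>X a \<iota>\<^sub>X \<A>\<^sub>Y a' \<iota>\<^sub>Y \<phi> \<Phi> f"
  shows "relation_square
    (sections_prod C D T U \<tau> \<A>\<^sub>Y) (sections_prod C D T U \<tau> \<A>\<^sub>X)
      (sections_list_rel C D T U \<tau> \<A>\<^sub>X \<A>\<^sub>Y \<phi> \<Phi>)
    (sections C D T U \<tau> a') (sections C D T U \<tau> a)
      (sections_rel C D T U \<tau> f)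
    (sections_map D T U \<iota>\<^sub>Y \<circ> parallel C D T U \<A>\<^sub>Y)
    (sections_map D T U \<iota>\<^sub>X \<circ> parallel C D T U \<A>\<^sub>X)"
proof -
  interpret D: cartesian_monoidal_category D by fact
  interpret \<tau>: monoidal_nat_trans C D T U \<tau> by fact
  have A: "A = arrow_cat C\<lparr>Obj := Obj A, Arr := Arr A\<rparr>" "Obj A \<subseteq> Obj (arrow_cat C)"
    "Arr A \<subseteq> Arr (arrow_cat C)" and "cartesian_monoidal_category A"
    using assms(9) by (simp_all add: cartesian_monoidal_subcategory_def)
  interpret A: cartesian_monoidal_category A by fact
  interpret open_systems C D T U \<tau> A
    by unfold_locales (fact A)+
  have net: "network C A \<A>\<^sub>X a \<iota>\<^sub>X" "network C A \<A>\<^sub>Y a' \<iota>\<^sub>Y" and lm: "list_morphism A \<A>\<^sub>X \<A>\<^sub>Y \<phi> \<Phi>"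
    and f: "f \<in> hom A a' a" and eq: "\<iota>\<^sub>X \<cdot>\<^bsub>A\<^esub> f = list_prod_map A \<A>\<^sub>X \<A>\<^sub>Y \<phi> \<Phi> \<cdot>\<^bsub>A\<^esub> \<iota>\<^sub>Y"
    using assms(10) by (simp_all add: network_morphism_def)
  have lX: "is_list A \<A>\<^sub>X" and lY: "is_list A \<A>\<^sub>Y"
    and iX: "interconnection C A a (list_prod A \<A>\<^sub>X) \<iota>\<^sub>X"
    and iY: "interconnection C A a' (list_prod A \<A>\<^sub>Y) \<iota>\<^sub>Y"
    using net by (simp_all add: network_def)
  \<comment> \<open>This types the right-hand square of the network equation, so that it can play
    the role of \<open>h\<close> in \<open>sections_map_related\<close>.\<close>
  have h: "list_prod_map A \<A>\<^sub>X \<A>\<^sub>Y \<phi> \<Phi> \<in> hom A (list_prod A \<A>\<^sub>Y) (list_prod A \<A>\<^sub>X)"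
    using list_prod_map_props[OF lm] by (auto intro: homI)
  show ?thesis
    unfolding relation_square_def
  proof (intro conjI)
    show "sections_list_rel C D T U \<tau> \<A>\<^sub>X \<A>\<^sub>Y \<phi> \<Phi>
      \<subseteq> sections_prod C D T U \<tau> \<A>\<^sub>Y \<times> sections_prod C D T U \<tau> \<A>\<^sub>X"
      by (auto simp: sections_list_rel_def)
    show "sections_rel C D T U \<tau> f \<subseteq> sections C D T U \<tau> a' \<times> sections C D T U \<tau> a"
      using homD[OF f] by (auto simp: sections_rel_def operations)
    show "sections_map D T U \<iota>\<^sub>Y \<circ> parallel C D T U \<A>\<^sub>Y
      \<in> sections_prod C D T U \<tau> \<A>\<^sub>Y \<rightarrow> sections C D T U \<tau> a'"
      using sections_map_section[OF iY parallel_section[OF lY]] by auto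
    show "sections_map D T U \<iota>\<^sub>X \<circ> parallel C D T U \<A>\<^sub>X
      \<in> sections_prod C D T U \<tau> \<A>\<^sub>X \<rightarrow> sections C D T U \<tau> a"
      using sections_map_section[OF iX parallel_section[OF lX]] by auto
    \<comment> \<open>Relatedness passes first from the families to their parallel composites, then
      along the interconnections by the commuting square of the network morphism.\<close>
    show "map_prod (sections_map D T U \<iota>\<^sub>Y \<circ> parallel C D T U \<A>\<^sub>Y)
        (sections_map D T U \<iota>\<^sub>X \<circ> parallel C D T U \<A>\<^sub>X) `
        sections_list_rel C D T U \<tau> \<A>\<^sub>X \<A>\<^sub>Y \<phi> \<Phi> \<subseteq> sections_rel C D T U \<tau> f"
      using sections_map_related[OF iX iY f h eq parallel_related[OF lm]] by auto
  qed
qed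

end
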